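(* Let $\mathcal{A}$ and $\mathcal{M}$ be unital $C^*$-algebras, and let $\Phi:\mathcal{A}\to\mathcal{M}$ be a positive linear map which is sub-unital, i.e. $\Phi(I)\le I$. Let $A\in\mathcal{A}$ be positive and let $0\le p\le q$ be real numbers. Then $$|\Phi(A^p)\Phi(A^q)|\le \Phi(A^{p+q}).$$
   Context: Units of both algebras are denoted by $I$. A linear map is positive if it maps positive elements to positive elements. For an element $X$ of a $C^*$-algebra, $|X|=(X^*X)^{1/2}$. Powers of positive elements are defined by functional calculus, with $A^0=I$. The order $\le$ is the usual order on self-adjoint elements ($X\le Y$ iff $Y-X$ is positive). *)

theory Defs
  imports Complex_Main
begin

text \<open>
  Unital \<open>C\<^sup>*\<close>-algebras. The real normed algebra structure is the restriction of scalars of the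
  complex one (axiom \<open>scaleR_scaleC\<close>). As usual for unital Banach algebras, the unit has norm 1,
  which is part of \<^class>\<open>real_normed_algebra_1\<close>.
\<close>

class cstar_algebra = real_normed_algebra_1 + banach +
  fixes scaleC :: "complex \<Rightarrow> 'a \<Rightarrow> 'a" (infixr "*\<^sub>C" 75)
    and star :: "'a \<Rightarrow> 'a"
  assumes scaleC_add_right: "c *\<^sub>C (x + y) = c *\<^sub>C x + c *\<^sub>C y"
    and scaleC_add_left: "(c + d) *\<^sub>C x = c *\<^sub>C x + d *\<^sub>C x"
    and scaleC_scaleC: "c *\<^sub>C (d *\<^sub>C x) = (c * d) *\<^sub>C x"
    and scaleC_one: "1 *\<^sub>C x = x"
    and scaleR_scaleC: "scaleR r x = complex_of_real r *\<^sub>C x"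
    and mult_scaleC_left: "(c *\<^sub>C x) * y = c *\<^sub>C (x * y)"
    and mult_scaleC_right: "x * (c *\<^sub>C y) = c *\<^sub>C (x * y)"
    and norm_scaleC: "norm (c *\<^sub>C x) = cmod c * norm x"
    and star_star: "star (star x) = x"
    and star_add: "star (x + y) = star x + star y"
    and star_scaleC: "star (c *\<^sub>C x) = cnj c *\<^sub>C star x"
    and star_mult: "star (x * y) = star y * star x"
    and cstar_identity: "norm (star x * x) = (norm x)\<^sup>2"

instantiation complex :: cstar_algebra
begin

definition scaleC_complex :: "complex \<Rightarrow> complex \<Rightarrow> complex"
  where "scaleC_complex c x = c * x"

definition star_complex :: "complex \<Rightarrow> complex"
  where "star_complex x = cnj x"

instance
  by standard
    (simp_all add: scaleC_complex_def star_complex_def algebra_simps norm_mult power2_eq_square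
      scaleR_conv_of_real)

end

definition cstar_spectrum :: "'a::cstar_algebra \<Rightarrow> complex set"
  where "cstar_spectrum a =
    {z. \<not> (\<exists>b. (z *\<^sub>C 1 - a) * b = 1 \<and> b * (z *\<^sub>C 1 - a) = 1)}"

definition cstar_selfadjoint :: "'a::cstar_algebra \<Rightarrow> bool"
  where "cstar_selfadjoint a \<longleftrightarrow> star a = a"

definition cstar_positive :: "'a::cstar_algebra \<Rightarrow> bool"
  where "cstar_positive a \<longleftrightarrow>
    cstar_selfadjoint a \<and> cstar_spectrum a \<subseteq> complex_of_real ` {0..}"

definition cstar_le :: "'a::cstar_algebra \<Rightarrow> 'a \<Rightarrow> bool"  (infix "\<le>\<^sub>*" 50)
  where "x \<le>\<^sub>* y \<longleftrightarrow>
    cstar_selfadjoint x \<and> cstar_selfadjoint y \<and> cstar_positive (y - x)"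

text \<open>
  \<open>cstar_cfc_hom a \<phi>\<close>: \<open>\<phi>\<close> is a unital \<open>*\<close>-homomorphism from the algebra of continuous complex
  functions on the spectrum of \<open>a\<close>, sending the inclusion of the spectrum to \<open>a\<close>.
  Functions on the spectrum are represented by total functions, hence the congruence clause.
  For normal \<open>a\<close> such a homomorphism exists and is unique on continuous functions.
\<close>

definition cstar_cfc_hom :: "'a::cstar_algebra \<Rightarrow> ((complex \<Rightarrow> complex) \<Rightarrow> 'a) \<Rightarrow> bool"
  where "cstar_cfc_hom a \<phi> \<longleftrightarrow>
    (\<forall>f g. continuous_on (cstar_spectrum a) f \<longrightarrow> (\<forall>z\<in>cstar_spectrum a. f z = g z)
        \<longrightarrow> \<phi> f = \<phi> g) \<and>
    (\<forall>f g. continuous_on (cstar_spectrum a) f \<longrightarrow> continuous_on (cstar_spectrum a) g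
        \<longrightarrow> \<phi> (\<lambda>z. f z + g z) = \<phi> f + \<phi> g \<and> \<phi> (\<lambda>z. f z * g z) = \<phi> f * \<phi> g) \<and>
    (\<forall>c f. continuous_on (cstar_spectrum a) f \<longrightarrow> \<phi> (\<lambda>z. c * f z) = c *\<^sub>C \<phi> f) \<and>
    (\<forall>f. continuous_on (cstar_spectrum a) f \<longrightarrow> \<phi> (\<lambda>z. cnj (f z)) = star (\<phi> f)) \<and>
    \<phi> (\<lambda>z. 1) = 1 \<and>
    \<phi> (\<lambda>z. z) = a"

text \<open>The continuous functional calculus \<open>f(a)\<close>, for normal \<open>a\<close> and \<open>f\<close> continuous on its spectrum.\<close>

definition cstar_cfc :: "(complex \<Rightarrow> complex) \<Rightarrow> 'a::cstar_algebra \<Rightarrow> 'a"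
  where "cstar_cfc f a = (THE b. \<exists>\<phi>. cstar_cfc_hom a \<phi> \<and> \<phi> f = b)"

text \<open>
  The power \<open>a\<^sup>p\<close> of a positive element, \<open>p \<ge> 0\<close>. The case distinction is needed because
  \<open>0 powr 0 = 0\<close> in HOL, whereas \<open>a\<^sup>0\<close> is the unit.
\<close>

definition cstar_powr :: "'a::cstar_algebra \<Rightarrow> real \<Rightarrow> 'a"
  where "cstar_powr a p =
    cstar_cfc (\<lambda>z. complex_of_real (if p = 0 then 1 else Re z powr p)) a"

definition cstar_abs :: "'a::cstar_algebra \<Rightarrow> 'a"
  where "cstar_abs x = cstar_powr (star x * x) (1/2)"

definition cstar_positive_linear_map :: "('a::cstar_algebra \<Rightarrow> 'b::cstar_algebra) \<Rightarrow> bool"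
  where "cstar_positive_linear_map \<Phi> \<longleftrightarrow>
    (\<forall>x y. \<Phi> (x + y) = \<Phi> x + \<Phi> y) \<and>
    (\<forall>c x. \<Phi> (c *\<^sub>C x) = c *\<^sub>C \<Phi> x) \<and>
    (\<forall>x. cstar_positive x \<longrightarrow> cstar_positive (\<Phi> x))"

end

theory Submission
  imports Defs "HOL-Analysis.Analysis" "HOL-Computational_Algebra.Fundamental_Theorem_Algebra"
begin

text \<open>
  Put \<open>a = A\<^sup>q\<close>, \<open>s = p/q\<close>, \<open>Y = \<Phi>(a)\<close> and \<open>B = \<Phi>(a\<^sup>s)\<close>. The Cauchy--Schwarz matrix with rows
  \<open>(\<Phi>(a\<^sup>u), \<Phi>(a\<^sup>w))\<close> and \<open>(\<Phi>(a\<^sup>w), \<Phi>(a\<^sup>v))\<close>, \<open>w = (u + v)/2\<close>, is positive, and together with the operator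
  monotonicity of the square root it yields Jensen's inequalities \<open>B \<le> Y\<^sup>s\<close> and
  \<open>Y\<^sup>1\<^sup>+\<^sup>s \<le> \<Phi>(a\<^sup>1\<^sup>+\<^sup>s)\<close>. Furuta's inequality turns \<open>B \<le> Y\<^sup>s\<close> into \<open>(Y B\<^sup>2 Y)\<^sup>1\<^sup>/\<^sup>2 \<le> Y\<^sup>1\<^sup>+\<^sup>s\<close>, whose left-hand
  side is \<open>|B Y|\<close>.
\<close>

section \<open>Elementary algebra\<close>

text \<open>Squaring is not operator monotone, so \<open>B \<le> Y^s\<close> does not yield
  \<open>B * B \<le> Y^(2 * s)\<close> and the absolute value cannot be estimated by comparing
  squares; Furuta's inequality is the substitute. It is applied to \<open>c = Y^s\<close> and
  \<open>d = B\<close> with exponent \<open>1 / s\<close>, which makes \<open>c^(1/s) = Y\<close>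
  and \<open>c^(1 + 1/s) = Y^(1 + s)\<close>. This excludes \<open>s = 0\<close>, hence the separate
  case \<open>p = 0\<close>. The map is merely positive, and for such maps the Cauchy-Schwarz matrix
  of arbitrary elements can fail to be positive; here all entries come from functions of the single
  element \<open>a\<close>, so that only a commutative algebra is involved. Several estimates use
  negative powers. They are proved for invertible elements and carried over by adding
  \<open>e\<close> times the unit and letting \<open>e\<close> tend to 0. The order and the
  functional calculus rest on one fact, that the norm of a self-adjoint element is at most its
  spectral radius; no representation on a Hilbert space is used.\<close>

lemma scaleC_zero_left [simp]: "0 *\<^sub>C x = (0::'a::cstar_algebra)"
  using scaleC_add_left[of 0 0 x] by simp

lemma scaleC_zero_right [simp]: "c *\<^sub>C (0::'a::cstar_algebra) = 0"
  using scaleC_add_right[of c 0 0] by simp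

lemma scaleC_minus_left: "(- c) *\<^sub>C x = - (c *\<^sub>C (x::'a::cstar_algebra))"
  using scaleC_add_left[of "-c" c x] by (simp add: eq_neg_iff_add_eq_0)

lemma scaleC_minus_right: "c *\<^sub>C (- x) = - (c *\<^sub>C (x::'a::cstar_algebra))"
  using scaleC_add_right[of c "-x" x] by (simp add: eq_neg_iff_add_eq_0)

lemma scaleC_diff_left: "(c - d) *\<^sub>C x = c *\<^sub>C x - d *\<^sub>C (x::'a::cstar_algebra)"
  using scaleC_add_left[of c "-d" x] by (simp add: scaleC_minus_left)

lemma scaleC_diff_right: "c *\<^sub>C (x - y) = c *\<^sub>C x - c *\<^sub>C (y::'a::cstar_algebra)"
  using scaleC_add_right[of c x "-y"] by (simp add: scaleC_minus_right)

lemmas scaleC_simps = scaleC_add_left scaleC_add_right scaleC_diff_left scaleC_diff_right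
  scaleC_minus_left scaleC_minus_right scaleC_scaleC mult_scaleC_left mult_scaleC_right

declare scaleC_one [simp] star_star [simp]

lemma star_zero [simp]: "star (0::'a::cstar_algebra) = 0"
  using star_add[of "0::'a" 0] by simp

lemma star_minus: "star (- x) = - star (x::'a::cstar_algebra)"
  using star_add[of "-x" x] by (simp add: eq_neg_iff_add_eq_0)

lemma star_diff: "star (x - y) = star x - star (y::'a::cstar_algebra)"
  using star_add[of x "-y"] by (simp add: star_minus)

lemma star_one [simp]: "star (1::'a::cstar_algebra) = 1"
  by (metis mult_1 mult_1_right star_mult star_star)

lemma star_scaleR: "star (r *\<^sub>R x) = r *\<^sub>R star (x::'a::cstar_algebra)"
  by (simp add: scaleR_scaleC star_scaleC)

lemma star_power: "star (x ^ n) = star (x::'a::cstar_algebra) ^ n"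
  by (induction n) (simp_all add: star_mult power_commutes)

lemmas star_simps = star_add star_minus star_diff star_mult star_scaleR star_scaleC

text \<open>The C*-identity and submultiplicativity give
  \<open>(norm x)\<^sup>2 \<le> norm (star x) * norm x\<close>; since \<open>star\<close> is an
  involution, one inequality suffices.\<close>

lemma norm_star [simp]: "norm (star x) = norm (x::'a::cstar_algebra)"
proof -
  have *: "norm x \<le> norm (star x)" for x :: 'a
  proof (cases "norm x = 0")
    case False
    have "norm x * norm x \<le> norm (star x) * norm x"
      using cstar_identity[of x] norm_mult_ineq[of "star x" x] by (simp add: power2_eq_square)
    with False show ?thesis by (simp add: mult_le_cancel_right)
  qed simp
  show ?thesis using *[of x] *[of "star x"] by simp
qed

lemma tendsto_star [tendsto_intros]:
  "(f \<longlongrightarrow> l) F \<Longrightarrow> ((\<lambda>x. star (f x)) \<longlongrightarrow> star (l::'a::cstar_algebra)) F"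
  by (simp add: tendsto_iff dist_norm flip: star_diff)

lemma bounded_linear_scaleC: "bounded_linear (\<lambda>x. c *\<^sub>C (x::'a::cstar_algebra))"
proof (rule bounded_linear_intro[where K = "cmod c"])
  show "c *\<^sub>C (r *\<^sub>R x) = r *\<^sub>R c *\<^sub>C x" for r and x :: 'a
    by (simp add: scaleR_scaleC scaleC_scaleC mult.commute)
qed (simp_all add: scaleC_add_right norm_scaleC mult.commute)

lemma tendsto_scaleC [tendsto_intros]:
  "(f \<longlongrightarrow> l) F \<Longrightarrow> ((\<lambda>x. c *\<^sub>C f x) \<longlongrightarrow> c *\<^sub>C (l::'a::cstar_algebra)) F"
  using bounded_linear.tendsto[OF bounded_linear_scaleC] .

lemma selfadjoint_simps:
  "cstar_selfadjoint (0::'a::cstar_algebra)"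
  "cstar_selfadjoint (1::'a)"
  "cstar_selfadjoint a \<Longrightarrow> cstar_selfadjoint b \<Longrightarrow> cstar_selfadjoint (a + b)"
  "cstar_selfadjoint a \<Longrightarrow> cstar_selfadjoint b \<Longrightarrow> cstar_selfadjoint (a - b)"
  "cstar_selfadjoint (a::'a) \<Longrightarrow> cstar_selfadjoint (- a)"
  "cstar_selfadjoint a \<Longrightarrow> cstar_selfadjoint (r *\<^sub>R a)"
  "cstar_selfadjoint a \<Longrightarrow> cstar_selfadjoint (a ^ n)"
  "cstar_selfadjoint (star x * x)"
  "cstar_selfadjoint (x * star x)"
  by (simp_all add: cstar_selfadjoint_def star_simps star_power)

lemma selfadjoint_conj: "cstar_selfadjoint a \<Longrightarrow> cstar_selfadjoint (star c * a * c)"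
  for a :: "'a::cstar_algebra"
  by (simp add: cstar_selfadjoint_def star_simps mult.assoc)

lemma norm_selfadjoint_square: "cstar_selfadjoint a \<Longrightarrow> norm (a * a) = (norm a)\<^sup>2"
  for a :: "'a::cstar_algebra"
  using cstar_identity[of a] by (simp add: cstar_selfadjoint_def)

section \<open>Invertible elements and the spectrum\<close>

definition is_inverse :: "'a::ring_1 \<Rightarrow> 'a \<Rightarrow> bool"
  where "is_inverse a b \<longleftrightarrow> a * b = 1 \<and> b * a = 1"

lemma is_inverse_unique: "is_inverse a b \<Longrightarrow> is_inverse a c \<Longrightarrow> b = c"
  unfolding is_inverse_def by (metis mult.assoc mult_1 mult_1_right)

lemma is_inverse_mult: "is_inverse a b \<Longrightarrow> is_inverse c d \<Longrightarrow> is_inverse (a * c) (d * b)"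
  unfolding is_inverse_def by (metis mult.assoc mult_1 mult_1_right)

lemma spectrum_iff: "z \<in> cstar_spectrum a \<longleftrightarrow> \<not> (\<exists>b. is_inverse (z *\<^sub>C 1 - a) b)"
  by (simp add: cstar_spectrum_def is_inverse_def)

lemma is_inverse_scaleC: "is_inverse a b \<Longrightarrow> c \<noteq> 0 \<Longrightarrow> is_inverse (c *\<^sub>C a) (inverse c *\<^sub>C b)"
  for a :: "'a::cstar_algebra"
  by (simp add: is_inverse_def scaleC_simps)

lemma is_inverse_minus: "is_inverse a b \<Longrightarrow> is_inverse (- a) (- b)"
  for a :: "'a::ring_1"
  by (simp add: is_inverse_def)

lemma zero_notin_spectrum_iff: "0 \<notin> cstar_spectrum a \<longleftrightarrow> (\<exists>b. is_inverse a b)"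
  using is_inverse_minus[of a] is_inverse_minus[of "-a"] by (auto simp: spectrum_iff)

lemma spectrum_scaleC:
  assumes "c \<noteq> 0" shows "c * z \<in> cstar_spectrum (c *\<^sub>C a) \<longleftrightarrow> z \<in> cstar_spectrum a"
proof -
  have "\<exists>y. is_inverse (d *\<^sub>C x) y" if "\<exists>y. is_inverse x y" "d \<noteq> 0" for x :: 'a and d
    using that is_inverse_scaleC by blast
  from this[of "z *\<^sub>C 1 - a" c] this[of "c *\<^sub>C (z *\<^sub>C 1 - a)" "inverse c"]
  have "(\<exists>y. is_inverse (c *\<^sub>C (z *\<^sub>C 1 - a)) y) \<longleftrightarrow> (\<exists>y. is_inverse (z *\<^sub>C 1 - a) y)"
    using assms by (auto simp: scaleC_scaleC)
  moreover have "(c * z) *\<^sub>C 1 - c *\<^sub>C a = c *\<^sub>C (z *\<^sub>C 1 - a)"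
    by (simp add: scaleC_simps)
  ultimately show ?thesis by (simp add: spectrum_iff)
qed

lemma spectrum_shift: "w + z \<in> cstar_spectrum (w *\<^sub>C 1 + a) \<longleftrightarrow> z \<in> cstar_spectrum a"
  by (simp add: spectrum_iff scaleC_simps algebra_simps)

lemma spectrum_minus: "- z \<in> cstar_spectrum (- a) \<longleftrightarrow> z \<in> cstar_spectrum a"
  using spectrum_scaleC[of "-1" z a] by (simp add: scaleC_minus_left)

lemma spectrum_shift_minus: "w - z \<in> cstar_spectrum (w *\<^sub>C 1 - a) \<longleftrightarrow> z \<in> cstar_spectrum a"
  using spectrum_shift[of w "-z" "-a"] by (simp add: spectrum_minus)

lemma neumann_inverse:
  fixes x :: "'a::{real_normed_algebra_1,banach}"
  assumes "norm x < 1" shows "\<exists>b. is_inverse (1 - x) b"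
proof -
  have s: "summable (\<lambda>n. x ^ n)"
    using assms by (rule complete_algebra_summable_geometric)
  let ?S = "\<Sum>n. x ^ n"
  have "x * ?S = (\<Sum>n. x ^ Suc n)" "?S * x = (\<Sum>n. x ^ Suc n)"
    using suminf_mult[OF s, of x] suminf_mult2[OF s, of x] by (simp_all add: power_commutes)
  moreover have "(\<Sum>n. x ^ Suc n) = ?S - 1"
    using suminf_minus_initial_segment[OF s, of 1] by simp
  ultimately show ?thesis
    by (intro exI[of _ ?S]) (simp add: is_inverse_def algebra_simps)
qed

text \<open>Geometric series suggest the formula, as
  \<open>y * (x * y) ^ n * x = (y * x) ^ (n + 1)\<close>; the identity itself is purely
  algebraic.\<close>

lemma is_inverse_one_minus_commute:
  assumes "is_inverse (1 - x * y) c" shows "is_inverse (1 - y * x) (1 + y * c * x)"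
proof -
  have 1: "c - x * y * c = 1" "c - c * x * y = 1"
    using assms by (simp_all add: is_inverse_def algebra_simps)
  have "(1 - y * x) * (1 + y * c * x) = 1 - y * x + y * (c - x * y * c) * x"
    by (simp add: algebra_simps)
  moreover have "(1 + y * c * x) * (1 - y * x) = 1 - y * x + y * (c - c * x * y) * x"
    by (simp add: algebra_simps)
  ultimately show ?thesis using 1 by (simp add: is_inverse_def)
qed

text \<open>Dividing by \<open>z\<close> reduces this to the invertibility of
  \<open>1 - x * y\<close> and \<open>1 - y * x\<close>. It serves to pass from
  \<open>star z * z\<close> to \<open>z * star z\<close>, and from
  \<open>b^(-1/2) * a * b^(-1/2)\<close> to \<open>a * b^(-1)\<close>.\<close>

lemma spectrum_mult_commute:
  assumes "z \<in> cstar_spectrum (x * y)" "z \<noteq> 0"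
  shows "z \<in> cstar_spectrum (y * x)"
proof (rule ccontr)
  have *: "w *\<^sub>C 1 - u * v = w *\<^sub>C (1 - (inverse w *\<^sub>C u) * v)" if "w \<noteq> 0" for w and u v :: 'a
    using that by (simp add: scaleC_simps)
  assume "z \<notin> cstar_spectrum (y * x)"
  then obtain b where "is_inverse (z *\<^sub>C (1 - (inverse z *\<^sub>C y) * x)) b"
    using *[OF assms(2)] by (auto simp: spectrum_iff)
  from is_inverse_scaleC[OF this, of "inverse z"] assms(2)
  obtain b' where "is_inverse (1 - (inverse z *\<^sub>C y) * x) b'"
    by (auto simp: scaleC_scaleC)
  from is_inverse_one_minus_commute[OF this]
  obtain b' where "is_inverse (1 - (inverse z *\<^sub>C x) * y) b'"
    by (auto simp: scaleC_simps)
  from is_inverse_scaleC[OF this assms(2)] *[OF assms(2), of x y] assms(1)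
  show False by (auto simp: spectrum_iff)
qed

lemma norm_le_of_mem_spectrum:
  assumes "z \<in> cstar_spectrum (a::'a::cstar_algebra)" shows "cmod z \<le> norm a"
proof (rule ccontr)
  assume "\<not> ?thesis"
  then have "cmod z > norm a" "cmod z > 0"
    using norm_ge_zero[of a] by linarith+
  then have z: "z \<noteq> 0" "norm (inverse z *\<^sub>C a) < 1"
    by (auto simp: norm_scaleC norm_inverse inverse_eq_divide norm_divide divide_less_eq)
  then obtain b where b: "is_inverse (1 - inverse z *\<^sub>C a) b"
    using neumann_inverse by blast
  have "z *\<^sub>C (1 - inverse z *\<^sub>C a) = z *\<^sub>C 1 - a"
    using z(1) by (simp add: scaleC_simps)
  with is_inverse_scaleC[OF b z(1)] assms show False
    by (auto simp: spectrum_iff)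
qed

text \<open>Quantitative continuity of inversion: \<open>u * y = 1 - u * (x - y)\<close> is
  invertible by the Neumann series. The bound 1/2, rather than 1, produces the factors 2 in the
  estimates.\<close>

lemma inverse_perturb:
  fixes x :: "'a::{real_normed_algebra_1,banach}"
  assumes u: "is_inverse x u" and y: "norm u * norm (x - y) \<le> 1/2"
  obtains v where "is_inverse y v" "norm v \<le> 2 * norm u"
    "norm (v - u) \<le> 2 * (norm u)\<^sup>2 * norm (x - y)"
proof -
  have "norm (u * (x - y)) < 1"
    using norm_mult_ineq[of u "x - y"] y by linarith
  then obtain w where "is_inverse (1 - u * (x - y)) w"
    using neumann_inverse by blast
  have "is_inverse y (w * u)"
  proof -
    have "1 - u * (x - y) = u * y" using u by (simp add: is_inverse_def algebra_simps)
    then have w: "w * (u * y) = 1" "u * (y * w) = 1"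
      using \<open>is_inverse (1 - u * (x - y)) w\<close> by (simp_all add: is_inverse_def mult.assoc)
    have "y * w = x" using w(2) u unfolding is_inverse_def by (metis mult.assoc mult_1 mult_1_right)
    then show ?thesis using u w by (simp add: is_inverse_def flip: mult.assoc)
  qed
  then obtain v where v: "is_inverse y v" by blast
  \<comment> \<open>Resolvent identity. It is used twice: first with \<open>norm v\<close> on the
    right, which is absorbed to give \<open>norm v \<le> 2 * norm u\<close>, then with that bound
    inserted.\<close>
  have eq: "v - u = v * (x - y) * u"
    using u v by (simp add: is_inverse_def algebra_simps)
  have "norm ((x - y) * u) \<le> 1/2"
    using norm_mult_ineq[of "x - y" u] y by (simp add: mult.commute)
  moreover have le: "norm (v - u) \<le> norm v * norm ((x - y) * u)"
    unfolding eq mult.assoc by (rule norm_mult_ineq)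
  ultimately have "norm (v - u) \<le> norm v * (1/2)"
    by (meson mult_left_mono norm_ge_zero order_trans)
  then have n: "norm v \<le> 2 * norm u"
    using norm_triangle_sub[of v u] by linarith
  have "norm (v - u) \<le> norm v * (norm (x - y) * norm u)"
    using le by (meson mult_left_mono norm_ge_zero norm_mult_ineq order_trans)
  also have "\<dots> \<le> (2 * norm u) * (norm (x - y) * norm u)"
    using n by (intro mult_right_mono) auto
  finally show ?thesis using that[OF v n] by (simp add: power2_eq_square mult_ac)
qed

lemma closed_spectrum: "closed (cstar_spectrum (a::'a::cstar_algebra))"
  unfolding closed_def open_dist
proof (intro ballI)
  fix z assume "z \<in> - cstar_spectrum a"
  then obtain u where u: "is_inverse (z *\<^sub>C 1 - a) u" by (auto simp: spectrum_iff)
  show "\<exists>e>0. \<forall>y. dist y z < e \<longrightarrow> y \<in> - cstar_spectrum a"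
  proof (intro exI[of _ "1 / (2 * (norm u + 1))"] conjI allI impI)
    fix y assume y: "dist y z < 1 / (2 * (norm u + 1))"
    have d: "norm (z *\<^sub>C 1 - a - (y *\<^sub>C 1 - a)) = dist y z"
      by (simp add: norm_scaleC dist_norm norm_minus_commute flip: scaleC_diff_left)
    have "norm u * dist y z \<le> (norm u + 1) * (1 / (2 * (norm u + 1)))"
      using y by (intro mult_mono) auto
    moreover have "norm u + 1 > 0" using norm_ge_zero[of u] by linarith
    then have "(norm u + 1) * (1 / (2 * (norm u + 1))) = 1/2" by simp
    ultimately have "norm u * dist y z \<le> 1/2" by (simp only:)
    then show "y \<in> - cstar_spectrum a"
      using inverse_perturb[OF u] d by (metis ComplI spectrum_iff)
  qed (simp add: add_nonneg_pos)
qed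

lemma compact_spectrum: "compact (cstar_spectrum (a::'a::cstar_algebra))"
  using closed_spectrum norm_le_of_mem_spectrum
  by (auto simp: compact_eq_bounded_closed bounded_iff)

text \<open>Adding \<open>\<i> * t\<close> to \<open>a\<close> raises the bound for the squared norm
  by \<open>t\<^sup>2\<close> only, because the cross terms cancel in the C*-identity, whereas the
  squared modulus of \<open>\<i> * t + z\<close> also gains the term
  \<open>2 * t * Im z\<close>.\<close>

lemma spectrum_of_selfadjoint_real:
  assumes a: "cstar_selfadjoint (a::'a::cstar_algebra)" and z: "z \<in> cstar_spectrum a"
  shows "Im z = 0"
proof (rule ccontr)
  assume im: "Im z \<noteq> 0"
  \<comment> \<open>Makes \<open>2 * t * Im z\<close> equal to \<open>(norm a)\<^sup>2 + 1\<close>,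
    one more than the estimate allows.\<close>
  define t where "t = ((norm a)\<^sup>2 + 1) / (2 * Im z)"
  have "\<i> * t + z \<in> cstar_spectrum ((\<i> * t) *\<^sub>C 1 + a)"
    using z by (simp add: spectrum_shift)
  then have "(cmod (\<i> * t + z))\<^sup>2 \<le> (norm ((\<i> * t) *\<^sub>C 1 + a))\<^sup>2"
    by (intro power_mono norm_le_of_mem_spectrum) auto
  also have "\<dots> = norm (complex_of_real (t\<^sup>2) *\<^sub>C 1 + a * a)"
  proof -
    have "star ((\<i> * t) *\<^sub>C 1 + a) * ((\<i> * t) *\<^sub>C 1 + a) = complex_of_real (t\<^sup>2) *\<^sub>C 1 + a * a"
      using a by (simp add: cstar_selfadjoint_def star_simps scaleC_simps algebra_simps power2_eq_square)
    then show ?thesis by (simp add: cstar_identity[symmetric])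
  qed
  also have "\<dots> \<le> t\<^sup>2 + (norm a)\<^sup>2"
    using a by (intro order_trans[OF norm_triangle_ineq])
      (simp add: norm_scaleC norm_selfadjoint_square norm_power)
  finally have "(cmod (\<i> * t + z))\<^sup>2 \<le> t\<^sup>2 + (norm a)\<^sup>2" .
  moreover have "(cmod (\<i> * t + z))\<^sup>2 = (Re z)\<^sup>2 + (Im z + t)\<^sup>2"
    by (simp add: cmod_power2 add.commute)
  ultimately have "(Re z)\<^sup>2 + (Im z)\<^sup>2 + 2 * t * Im z \<le> (norm a)\<^sup>2"
    by (simp add: cmod_power2 power2_eq_square algebra_simps)
  moreover have "2 * t * Im z = (norm a)\<^sup>2 + 1"
    using im by (simp add: t_def)
  ultimately show False
    using zero_le_power2[of "Re z"] zero_le_power2[of "Im z"] by linarith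
qed

section \<open>The spectral radius bound for self-adjoint elements\<close>

lemma tendsto_is_inverse:
  fixes x :: "'a::{real_normed_algebra_1,banach}"
  assumes f: "(f \<longlongrightarrow> x) F" and u: "is_inverse x u"
    and g: "eventually (\<lambda>t. is_inverse (f t) (g t)) F"
  shows "(g \<longlongrightarrow> u) F"
proof -
  have n: "((\<lambda>t. norm (x - f t)) \<longlongrightarrow> 0) F"
    using tendsto_norm[OF tendsto_diff[OF tendsto_const f, of x]] by simp
  have "((\<lambda>t. norm u * norm (x - f t)) \<longlongrightarrow> norm u * 0) F"
    by (intro tendsto_intros n)
  then have "eventually (\<lambda>t. norm u * norm (x - f t) < 1/2) F"
    by (rule order_tendstoD(2)) simp
  then have "eventually (\<lambda>t. norm (g t - u) \<le> 2 * (norm u)\<^sup>2 * norm (x - f t)) F"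
    using g
  proof eventually_elim
    case (elim t)
    from elim(1) have "norm u * norm (x - f t) \<le> 1/2" by simp
    from inverse_perturb[OF u this] obtain v where
      "is_inverse (f t) v" "norm (v - u) \<le> 2 * (norm u)\<^sup>2 * norm (x - f t)" by blast
    with elim(2) is_inverse_unique show ?case by blast
  qed
  moreover have "((\<lambda>t. 2 * (norm u)\<^sup>2 * norm (x - f t)) \<longlongrightarrow> 2 * (norm u)\<^sup>2 * 0) F"
    by (intro tendsto_intros n)
  ultimately have "((\<lambda>t. g t - u) \<longlongrightarrow> 0) F"
    unfolding mult_zero_right by (rule Lim_null_comparison)
  then show ?thesis by (simp add: LIM_zero_iff)
qed

text \<open>
  This closeness of the resolvents at \<open>w\<close> and \<open>l w\<close> passes from \<open>(a, l)\<close> to \<open>(a\<^sup>2, l\<^sup>2)\<close>, because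
  \<open>(1 - x\<^sup>2)\<^sup>-\<^sup>1\<close> is the average of \<open>(1 - x)\<^sup>-\<^sup>1\<close> and \<open>(1 + x)\<^sup>-\<^sup>1\<close>. If the spectrum of \<open>a\<close> lies in the
  open unit disc, iterating shows that the powers \<open>a\<^sup>n\<close>, \<open>n = 2\<^sup>k\<close>, cannot all have norm 1. This
  bounds the norm of a self-adjoint element by its spectral radius without complex analysis.
\<close>

definition resolvents_close :: "'a::cstar_algebra \<Rightarrow> real \<Rightarrow> real \<Rightarrow> bool"
  where "resolvents_close a l e \<longleftrightarrow> (\<forall>w. cmod w = 1 \<longrightarrow>
    (\<exists>u v. is_inverse (1 - w *\<^sub>C a) u \<and> is_inverse (1 - (l * w) *\<^sub>C a) v \<and> norm (u - v) \<le> e))"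

lemma is_inverse_one_minus_square:
  fixes x :: "'a::cstar_algebra"
  assumes u: "is_inverse (1 - x) u" and v: "is_inverse (1 + x) v"
  shows "is_inverse (1 - x * x) ((1/2) *\<^sub>R (u + v))"
proof -
  have 1: "u = 1 + x * u" "u = 1 + u * x" "v = 1 - x * v" "v = 1 - v * x"
    using u v by (simp_all add: is_inverse_def algebra_simps)
  have a: "(1 - x * x) * u = 1 + x" "u * (1 - x * x) = 1 + x"
  proof -
    have "(1 - x * x) * u = (1 + x) * ((1 - x) * u)" "u * (1 - x * x) = (u * (1 - x)) * (1 + x)"
      by (simp_all add: algebra_simps)
    then show "(1 - x * x) * u = 1 + x" "u * (1 - x * x) = 1 + x"
      using u by (simp_all add: is_inverse_def)
  qed
  have b: "(1 - x * x) * v = 1 - x" "v * (1 - x * x) = 1 - x"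
  proof -
    have "(1 - x * x) * v = (1 - x) * ((1 + x) * v)" "v * (1 - x * x) = (v * (1 + x)) * (1 - x)"
      by (simp_all add: algebra_simps)
    then show "(1 - x * x) * v = 1 - x" "v * (1 - x * x) = 1 - x"
      using v by (simp_all add: is_inverse_def)
  qed
  have "(1/2) *\<^sub>R ((1 + x) + (1 - x)) = (1/2) *\<^sub>R (2 *\<^sub>R (1::'a))" by (simp add: scaleR_2)
  then have "(1/2) *\<^sub>R ((1 + x) + (1 - x)) = 1" unfolding scaleR_scaleR by simp
  then show ?thesis
    unfolding is_inverse_def mult_scaleR_left mult_scaleR_right distrib_left distrib_right a b by blast
qed

lemma resolvents_close_square:
  assumes "resolvents_close a l e" shows "resolvents_close (a * a) (l\<^sup>2) e"
  unfolding resolvents_close_def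
proof (intro allI impI)
  fix w assume w: "cmod w = 1"
  \<comment> \<open>Both square roots of \<open>w\<close> lie on the unit circle. The resolvents of
    \<open>a * a\<close> are averages over the two roots, so the averaged difference is again at
    most \<open>e\<close>.\<close>
  have c: "cmod (csqrt w) = 1" "cmod (- csqrt w) = 1" using w by (simp_all add: norm_csqrt)
  obtain u v where 1: "is_inverse (1 - csqrt w *\<^sub>C a) u" "is_inverse (1 - (l * csqrt w) *\<^sub>C a) v"
    "norm (u - v) \<le> e"
    using assms c(1) unfolding resolvents_close_def by blast
  obtain u' v' where 2: "is_inverse (1 - (- csqrt w) *\<^sub>C a) u'"
    "is_inverse (1 - (l * (- csqrt w)) *\<^sub>C a) v'" "norm (u' - v') \<le> e"
    using assms c(2) unfolding resolvents_close_def by blast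
  have "csqrt w * csqrt w = w" by (metis power2_csqrt power2_eq_square)
  then have sq: "(csqrt w *\<^sub>C a) * (csqrt w *\<^sub>C a) = w *\<^sub>C (a * a)"
    "((l * csqrt w) *\<^sub>C a) * ((l * csqrt w) *\<^sub>C a) = (l\<^sup>2 * w) *\<^sub>C (a * a)"
    by (auto simp: scaleC_simps power2_eq_square intro!: arg_cong[of _ _ "\<lambda>z. z *\<^sub>C (a * a)"])
  have i1: "is_inverse (1 - w *\<^sub>C (a * a)) ((1/2) *\<^sub>R (u + u'))"
    using is_inverse_one_minus_square[OF 1(1), of u'] 2(1) by (simp add: sq scaleC_minus_left)
  have i2: "is_inverse (1 - (l\<^sup>2 * w) *\<^sub>C (a * a)) ((1/2) *\<^sub>R (v + v'))"
    using is_inverse_one_minus_square[OF 1(2), of v'] 2(2) by (simp add: sq scaleC_minus_left)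
  have "(1/2) *\<^sub>R (u + u') - (1/2) *\<^sub>R (v + v') = (1/2) *\<^sub>R ((u - v) + (u' - v'))"
    by (simp add: algebra_simps)
  then have n: "norm ((1/2) *\<^sub>R (u + u') - (1/2) *\<^sub>R (v + v')) \<le> e"
    using norm_triangle_ineq[of "u - v" "u' - v'"] 1(3) 2(3) by simp
  show "\<exists>u v. is_inverse (1 - w *\<^sub>C (a * a)) u \<and>
      is_inverse (1 - (complex_of_real (l\<^sup>2) * w) *\<^sub>C (a * a)) v \<and> norm (u - v) \<le> e"
    by (rule exI[of _ "(1/2) *\<^sub>R (u + u')"], rule exI[of _ "(1/2) *\<^sub>R (v + v')"])
      (use i1 i2 n in simp)
qed

lemma resolvents_close_power:
  "resolvents_close a l e \<Longrightarrow> resolvents_close (a ^ (2 ^ k)) (l ^ (2 ^ k)) e"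
proof (induction k)
  case (Suc k)
  then show ?case
    using resolvents_close_square[of "a ^ 2 ^ k" "l ^ 2 ^ k" e]
    by (simp add: mult.commute[of 2] power_mult power2_eq_square flip: power_add)
qed simp

text \<open>The spectral hypothesis provides the resolvents on the unit circle; they depend
  continuously on \<open>w\<close>, so compactness bounds them by some \<open>N\<close>. Moving from
  \<open>w\<close> to \<open>(1 - d) * w\<close> then costs at most
  \<open>2 * N\<^sup>2 * norm a * d\<close>.\<close>

lemma exists_resolvents_close:
  assumes spec: "\<And>z. z \<in> cstar_spectrum (a::'a::cstar_algebra) \<Longrightarrow> cmod z < 1" and e: "e > 0"
  obtains l where "0 < l" "l < 1" "resolvents_close a l e"
proof -
  have "\<exists>u. is_inverse (1 - w *\<^sub>C a) u" if w: "cmod w = 1" for w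
  proof -
    have "cmod (inverse w) = 1" using w by (simp add: norm_inverse)
    then obtain b where b: "is_inverse (inverse w *\<^sub>C 1 - a) b"
      using spec[of "inverse w"] by (auto simp: spectrum_iff)
    have "w \<noteq> 0" using w by auto
    then show ?thesis using is_inverse_scaleC[OF b, of w] by (auto simp: scaleC_simps)
  qed
  then obtain g where g: "\<And>w. cmod w = 1 \<Longrightarrow> is_inverse (1 - w *\<^sub>C a) (g w)"
    by metis
  have "continuous_on (sphere 0 1) g"
    unfolding continuous_on_def
  proof
    fix w :: complex assume w: "w \<in> sphere 0 1"
    have "((\<lambda>z. 1 - z *\<^sub>C a) \<longlongrightarrow> 1 - w *\<^sub>C a) (at w within sphere 0 1)"
    proof -
      have "((\<lambda>z. norm (z - w) * norm a) \<longlongrightarrow> norm (w - w) * norm a) (at w within sphere 0 1)"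
        by (intro tendsto_intros)
      then show ?thesis
        by (intro tendsto_diff tendsto_const, subst tendsto_dist_iff)
          (simp add: dist_norm norm_scaleC flip: scaleC_diff_left)
    qed
    then show "(g \<longlongrightarrow> g w) (at w within sphere 0 1)"
    proof (rule tendsto_is_inverse)
      show "is_inverse (1 - w *\<^sub>C a) (g w)" using g w by simp
      show "eventually (\<lambda>z. is_inverse (1 - z *\<^sub>C a) (g z)) (at w within sphere 0 1)"
        using g by (auto simp: eventually_at_filter intro!: always_eventually)
    qed
  qed
  then have "bounded (g ` sphere 0 1)"
    by (intro compact_imp_bounded compact_continuous_image) auto
  then obtain N where N: "N > 0" "\<And>w. cmod w = 1 \<Longrightarrow> norm (g w) \<le> N"
    by (auto simp: bounded_pos)
  define K where "K = 2 * N\<^sup>2 * norm a"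
  \<comment> \<open>The term 1/2 keeps \<open>1 - d\<close> positive, the second one makes
    \<open>K * d\<close> at most \<open>e\<close>, and the third one makes
    \<open>inverse_perturb\<close> applicable.\<close>
  define d where "d = min (1/2) (min (e / (K + 1)) (1 / (2 * N * (norm a + 1))))"
  have K: "K \<ge> 0" by (simp add: K_def)
  have na: "norm a + 1 > 0" using norm_ge_zero[of a] by linarith
  have "0 < e / (K + 1)" using e K by simp
  moreover have "0 < 1 / (2 * N * (norm a + 1))" using N(1) na by simp
  ultimately have d: "0 < d" "d < 1" "d \<le> e / (K + 1)" "d \<le> 1 / (2 * N * (norm a + 1))"
    by (auto simp: d_def)
  have dK: "K * d \<le> e"
  proof -
    have "(K + 1) * d \<le> e" using d(3) K by (simp add: field_simps)
    then show ?thesis using d(1) by (simp add: algebra_simps)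
  qed
  have dN: "N * (d * norm a) \<le> 1/2"
  proof -
    have "d * (2 * N * (norm a + 1)) \<le> 1"
      using d(4) N(1) na by (subst (asm) pos_le_divide_eq) auto
    moreover have "0 \<le> d * (2 * N)" using d(1) N(1) by simp
    ultimately show ?thesis by (simp add: algebra_simps)
  qed
  have "resolvents_close a (1 - d) e"
    unfolding resolvents_close_def
  proof (intro allI impI)
    fix w assume w: "cmod w = 1"
    have "1 - w *\<^sub>C a - (1 - (complex_of_real (1 - d) * w) *\<^sub>C a) = (- complex_of_real d * w) *\<^sub>C a"
      by (simp add: scaleC_simps algebra_simps)
    then have n: "norm (1 - w *\<^sub>C a - (1 - (complex_of_real (1 - d) * w) *\<^sub>C a)) = d * norm a"
      using d(1) w by (simp add: norm_scaleC norm_mult)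
    have "norm (g w) * (d * norm a) \<le> N * (d * norm a)"
      using N(2)[OF w] d(1) by (intro mult_right_mono) auto
    then have "norm (g w) * (d * norm a) \<le> 1/2" using dN by linarith
    then obtain v where v: "is_inverse (1 - (complex_of_real (1 - d) * w) *\<^sub>C a) v"
      "norm (v - g w) \<le> 2 * (norm (g w))\<^sup>2 * (d * norm a)"
      using inverse_perturb[OF g[OF w]] n by metis
    note v(2)
    also have "2 * (norm (g w))\<^sup>2 * (d * norm a) \<le> 2 * N\<^sup>2 * (d * norm a)"
      using N(2)[OF w] d(1) by (intro mult_right_mono mult_left_mono power_mono) auto
    also have "\<dots> \<le> e" using dK by (simp add: K_def mult_ac)
    finally show "\<exists>u v. is_inverse (1 - w *\<^sub>C a) u \<and>
        is_inverse (1 - (complex_of_real (1 - d) * w) *\<^sub>C a) v \<and> norm (u - v) \<le> e"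
      using g[OF w] v(1) by (metis norm_minus_commute)
  qed
  with d show ?thesis by (intro that[of "1 - d"]) auto
qed

lemma norm_selfadjoint_power:
  assumes "cstar_selfadjoint (a::'a::cstar_algebra)" shows "norm (a ^ (2 ^ k)) = norm a ^ (2 ^ k)"
proof (induction k)
  case (Suc k)
  have "norm (a ^ 2 ^ Suc k) = norm (a ^ 2 ^ k * a ^ 2 ^ k)"
    by (simp add: mult_2 flip: power_add)
  also have "\<dots> = (norm (a ^ 2 ^ k))\<^sup>2"
    by (intro norm_selfadjoint_square selfadjoint_simps assms)
  finally show ?case by (simp add: Suc mult.commute[of 2] power_mult)
qed simp

text \<open>Otherwise closeness survives repeated squaring with a fixed \<open>e\<close>, while the
  powers of \<open>l\<close> tend to 0. The resolvent \<open>v\<close> of a high power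
  \<open>x\<close> of \<open>a\<close> at the tiny parameter is nearly 1, hence so is the resolvent
  \<open>u\<close> at 1; but then \<open>x\<close> itself is small, although self-adjointness keeps
  its norm equal to 1.\<close>

lemma exists_spectrum_of_norm_one:
  assumes a: "cstar_selfadjoint (a::'a::cstar_algebra)" "norm a = 1"
  shows "\<exists>z\<in>cstar_spectrum a. cmod z \<ge> 1"
proof (rule ccontr)
  assume "\<not> ?thesis"
  then obtain l where l: "0 < l" "l < 1" "resolvents_close a l (1/16)"
    using exists_resolvents_close[of a "1/16"] by (auto simp: not_le)
  have "(\<lambda>n. l ^ n) \<longlonglongrightarrow> 0" using l by (intro LIMSEQ_power_zero) auto
  then have "eventually (\<lambda>n. l ^ n < 1/32) sequentially" by (rule order_tendstoD) simp
  then obtain n0 where n0: "\<And>n. n \<ge> n0 \<Longrightarrow> l ^ n < 1/32"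
    by (auto simp: eventually_sequentially)
  \<comment> \<open>Squaring reaches only exponents that are powers of two; \<open>2 ^ n0\<close> is
    one of them and is at least \<open>n0\<close>.\<close>
  define m where "m = l ^ 2 ^ n0"
  define x where "x = a ^ 2 ^ n0"
  have m: "0 < m" "m < 1/32" using l n0[of "2 ^ n0"] by (auto simp: m_def less_imp_le)
  have x: "norm x = 1" using norm_selfadjoint_power[OF a(1)] a(2) by (simp add: x_def)
  have "resolvents_close x m (1/16)" using resolvents_close_power[OF l(3)] by (simp add: x_def m_def)
  then obtain u v where uv: "is_inverse (1 - x) u" "is_inverse (1 - complex_of_real m *\<^sub>C x) v"
    "norm (u - v) \<le> 1/16"
    unfolding resolvents_close_def by (force dest: spec[of _ 1])
  let ?y = "complex_of_real m *\<^sub>C x"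
  have y: "norm ?y \<le> 1/32" using m x by (simp add: norm_scaleC)
  have "v - 1 = ?y + (v - 1) * ?y"
    using uv(2) by (simp add: is_inverse_def algebra_simps)
  then have "norm (v - 1) \<le> norm ?y + norm ((v - 1) * ?y)"
    by (metis norm_triangle_ineq)
  also have "\<dots> \<le> 1/32 + norm (v - 1) * (1/32)"
    using y by (intro add_mono order_trans[OF norm_mult_ineq] mult_left_mono) auto
  finally have "norm (v - 1) \<le> 1/16" by simp
  then have u1: "norm (u - 1) \<le> 1/8"
    using norm_triangle_ineq[of "u - v" "v - 1"] uv(3) by simp
  have "x = (u - 1) - (u - 1) * x"
    using uv(1) by (simp add: is_inverse_def algebra_simps)
  then have "norm x \<le> norm (u - 1) + norm ((u - 1) * x)"
    by (metis norm_triangle_ineq4)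
  also have "\<dots> \<le> 1/8 + 1/8 * norm x"
    using u1 by (intro add_mono order_trans[OF norm_mult_ineq] mult_right_mono) auto
  finally show False using x by simp
qed

text \<open>Rescaling to norm 1. Through this lemma norm estimates for self-adjoint elements, and
  via \<open>cstar_identity\<close> for others, become statements about spectra.\<close>

lemma norm_selfadjoint_le:
  assumes a: "cstar_selfadjoint (a::'a::cstar_algebra)" and r: "r \<ge> 0"
    and spec: "\<And>z. z \<in> cstar_spectrum a \<Longrightarrow> cmod z \<le> r"
  shows "norm a \<le> r"
proof (rule ccontr)
  assume n: "\<not> ?thesis"
  then have pos: "norm a > 0" using r by linarith
  let ?b = "complex_of_real (1 / norm a) *\<^sub>C a"
  have "cstar_selfadjoint ?b"
    using a unfolding scaleR_scaleC[symmetric] by (rule selfadjoint_simps)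
  moreover have "norm ?b = 1" using pos by (simp add: norm_scaleC norm_divide)
  ultimately obtain z where z: "z \<in> cstar_spectrum ?b" "cmod z \<ge> 1"
    using exists_spectrum_of_norm_one by blast
  have "complex_of_real (norm a) * z \<in> cstar_spectrum a"
    using spectrum_scaleC[of "complex_of_real (norm a)" z ?b] z(1) pos
    by (simp add: scaleC_scaleC)
  then have "norm a * cmod z \<le> r" using spec by (force simp: norm_mult)
  moreover have "norm a * 1 \<le> norm a * cmod z" using z(2) by (intro mult_left_mono) auto
  ultimately show False using n by simp
qed

section \<open>Positive elements\<close>

text \<open>For real spectrum inside \<open>[-t, t]\<close>, nonnegativity amounts to
  \<open>t - a\<close> having spectrum in \<open>[-t, t]\<close>, which is a norm condition. Unlike
  the spectral definition it behaves well under sums (triangle inequality) and under limits.\<close>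

lemma positive_iff_norm:
  assumes "cstar_selfadjoint (a::'a::cstar_algebra)" "norm a \<le> t"
  shows "cstar_positive a \<longleftrightarrow> norm (t *\<^sub>R 1 - a) \<le> t"
proof
  assume p: "cstar_positive a"
  show "norm (t *\<^sub>R 1 - a) \<le> t"
  proof (rule norm_selfadjoint_le)
    show "t \<ge> 0" using assms(2) norm_ge_zero[of a] by linarith
    fix z assume "z \<in> cstar_spectrum (t *\<^sub>R 1 - a)"
    then have z: "of_real t - z \<in> cstar_spectrum a"
      using spectrum_shift_minus[of "of_real t" "of_real t - z" a] by (simp add: scaleR_scaleC)
    then obtain s where s: "of_real t - z = of_real s" "s \<ge> 0"
      using p by (auto simp: cstar_positive_def)
    have "\<bar>s\<bar> \<le> t" using norm_le_of_mem_spectrum[OF z] assms(2) s(1) by simp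
    moreover have "z = of_real (t - s)" using s(1) by (simp add: algebra_simps)
    ultimately show "cmod z \<le> t" using s(2) by (simp only: norm_of_real)
  qed (use assms in \<open>simp add: selfadjoint_simps\<close>)
next
  assume n: "norm (t *\<^sub>R 1 - a) \<le> t"
  have "z \<in> complex_of_real ` {0..}" if z: "z \<in> cstar_spectrum a" for z
  proof -
    have im: "z = of_real (Re z)" using spectrum_of_selfadjoint_real[OF assms(1) z] by (simp add: complex_eq_iff)
    have "of_real t - z \<in> cstar_spectrum (t *\<^sub>R 1 - a)"
      using z spectrum_shift_minus[of "of_real t" z a] by (simp add: scaleR_scaleC)
    then have "cmod (of_real (t - Re z)) \<le> t"
      using norm_le_of_mem_spectrum n im by (metis of_real_diff order_trans)
    then have "Re z \<ge> 0" by (simp only: norm_of_real)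
    with im show ?thesis by (metis atLeast_iff imageI)
  qed
  then show "cstar_positive a" using assms(1) by (auto simp: cstar_positive_def)
qed

lemma positive_selfadjoint: "cstar_positive a \<Longrightarrow> cstar_selfadjoint a"
  by (simp add: cstar_positive_def)

lemma positive_star: "cstar_positive a \<Longrightarrow> star a = a"
  by (simp add: cstar_positive_def cstar_selfadjoint_def)

lemma positive_zero [simp]: "cstar_positive (0::'a::cstar_algebra)"
  using positive_iff_norm[of "0::'a" 0] by (simp add: selfadjoint_simps)

lemma positive_add:
  assumes "cstar_positive a" "cstar_positive (b::'a::cstar_algebra)"
  shows "cstar_positive (a + b)"
proof -
  have "norm (norm a *\<^sub>R 1 - a) \<le> norm a" "norm (norm b *\<^sub>R 1 - b) \<le> norm b"
    using assms positive_iff_norm positive_selfadjoint by blast+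
  then have "norm ((norm a *\<^sub>R 1 - a) + (norm b *\<^sub>R 1 - b)) \<le> norm a + norm b"
    by (rule norm_triangle_mono)
  moreover have "(norm a *\<^sub>R 1 - a) + (norm b *\<^sub>R 1 - b) = (norm a + norm b) *\<^sub>R 1 - (a + b)"
    by (simp add: algebra_simps)
  ultimately have "norm ((norm a + norm b) *\<^sub>R 1 - (a + b)) \<le> norm a + norm b" by simp
  then show ?thesis
    using assms positive_iff_norm[of "a + b" "norm a + norm b"] norm_triangle_ineq[of a b]
    by (simp add: positive_selfadjoint selfadjoint_simps)
qed

lemma positive_scaleR:
  assumes "cstar_positive (a::'a::cstar_algebra)" "r \<ge> 0"
  shows "cstar_positive (r *\<^sub>R a)"
proof -
  have "norm (norm a *\<^sub>R 1 - a) \<le> norm a"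
    using assms positive_iff_norm positive_selfadjoint by blast
  then have "r * norm (norm a *\<^sub>R 1 - a) \<le> r * norm a" using assms(2) by (rule mult_left_mono)
  moreover have "(r * norm a) *\<^sub>R 1 - r *\<^sub>R a = r *\<^sub>R (norm a *\<^sub>R 1 - a)"
    by (simp add: algebra_simps)
  ultimately have "norm ((r * norm a) *\<^sub>R 1 - r *\<^sub>R a) \<le> r * norm a" using assms(2) by simp
  then show ?thesis
    using assms positive_iff_norm[of "r *\<^sub>R a" "r * norm a"]
    by (simp add: positive_selfadjoint selfadjoint_simps)
qed

lemma positive_one [simp]: "cstar_positive (1::'a::cstar_algebra)"
  using positive_iff_norm[of "1::'a" 1] by (simp add: selfadjoint_simps)

lemma positive_sum:
  "(\<And>i. i \<in> I \<Longrightarrow> cstar_positive (f i :: 'a::cstar_algebra)) \<Longrightarrow> cstar_positive (sum f I)"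
  by (induction I rule: infinite_finite_induct) (auto intro: positive_add)

lemma tendsto_selfadjoint:
  assumes "(f \<longlongrightarrow> (a::'a::cstar_algebra)) F" "F \<noteq> bot" "eventually (\<lambda>x. cstar_selfadjoint (f x)) F"
  shows "cstar_selfadjoint a"
proof -
  have "(f \<longlongrightarrow> star a) F"
    by (rule Lim_transform_eventually[OF tendsto_star[OF assms(1)]])
      (use assms(3) in \<open>auto elim!: eventually_mono simp: cstar_selfadjoint_def\<close>)
  then show ?thesis using assms tendsto_unique unfolding cstar_selfadjoint_def by blast
qed

lemma tendsto_positive:
  assumes "(f \<longlongrightarrow> (a::'a::cstar_algebra)) F" "F \<noteq> bot" "eventually (\<lambda>x. cstar_positive (f x)) F"
  shows "cstar_positive a"
proof -
  have "eventually (\<lambda>x. norm (norm (f x) *\<^sub>R 1 - f x) \<le> norm (f x)) F"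
    using assms(3) by eventually_elim (use positive_iff_norm positive_selfadjoint in blast)
  then have "norm (norm a *\<^sub>R 1 - a) \<le> norm a"
    by (rule tendsto_le[OF assms(2), rotated -1]) (intro tendsto_intros assms)+
  moreover have "cstar_selfadjoint a"
    using assms tendsto_selfadjoint by (metis (mono_tags, lifting) eventually_mono positive_selfadjoint)
  ultimately show ?thesis using positive_iff_norm by blast
qed

lemma positive_antisym:
  assumes "cstar_positive a" "cstar_positive (- a)" shows "a = (0::'a::cstar_algebra)"
proof -
  have "norm a \<le> 0"
  proof (rule norm_selfadjoint_le)
    fix z assume "z \<in> cstar_spectrum a"
    then have "z \<in> complex_of_real ` {0..}" "- z \<in> complex_of_real ` {0..}"
      using assms spectrum_minus unfolding cstar_positive_def by blast+
    then show "cmod z \<le> 0" by (auto simp: complex_eq_iff)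
  qed (use assms positive_selfadjoint in auto)
  then show ?thesis by simp
qed

section \<open>The order, its limits and its relation to the norm\<close>

lemma cstar_le_refl: "cstar_selfadjoint a \<Longrightarrow> a \<le>\<^sub>* a"
  by (simp add: cstar_le_def)

lemma cstar_le_trans: "a \<le>\<^sub>* b \<Longrightarrow> b \<le>\<^sub>* c \<Longrightarrow> a \<le>\<^sub>* c"
  using positive_add[of "b - a" "c - b"] by (simp add: cstar_le_def)

lemma le_add_mono: "a \<le>\<^sub>* b \<Longrightarrow> c \<le>\<^sub>* d \<Longrightarrow> a + c \<le>\<^sub>* b + d"
  using positive_add[of "b - a" "d - c"] by (simp add: cstar_le_def selfadjoint_simps algebra_simps)

lemma positive_iff_le: "cstar_positive a \<longleftrightarrow> 0 \<le>\<^sub>* a"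
  by (auto simp: cstar_le_def cstar_positive_def selfadjoint_simps)

lemma positive_of_le: "cstar_positive a \<Longrightarrow> a \<le>\<^sub>* b \<Longrightarrow> cstar_positive b"
  using positive_iff_le cstar_le_trans by blast

lemma le_minus: "a \<le>\<^sub>* b \<Longrightarrow> - b \<le>\<^sub>* - a"
  by (simp add: cstar_le_def selfadjoint_simps)

lemma tendsto_cstar_le:
  assumes "(f \<longlongrightarrow> (a::'a::cstar_algebra)) F" "(g \<longlongrightarrow> b) F" "F \<noteq> bot" "eventually (\<lambda>x. f x \<le>\<^sub>* g x) F"
  shows "a \<le>\<^sub>* b"
proof -
  have "cstar_selfadjoint a" "cstar_selfadjoint b"
    using assms(4) by (auto intro!: tendsto_selfadjoint[OF _ assms(3)] assms(1,2)
        elim!: eventually_mono simp: cstar_le_def)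
  moreover have "cstar_positive (b - a)"
    by (rule tendsto_positive[OF tendsto_diff[OF assms(2,1)] assms(3)])
      (use assms(4) in \<open>auto elim!: eventually_mono simp: cstar_le_def\<close>)
  ultimately show ?thesis by (simp add: cstar_le_def)
qed

lemma positive_norm_minus:
  assumes "cstar_selfadjoint (a::'a::cstar_algebra)" "norm a \<le> t"
  shows "cstar_positive (t *\<^sub>R 1 - a)"
proof -
  have "z \<in> complex_of_real ` {0..}" if "z \<in> cstar_spectrum (t *\<^sub>R 1 - a)" for z
  proof -
    have z: "of_real t - z \<in> cstar_spectrum a"
      using that spectrum_shift_minus[of "of_real t" "of_real t - z" a] by (simp add: scaleR_scaleC)
    have "z = of_real (Re z)"
      using spectrum_of_selfadjoint_real[OF assms(1) z] by (simp add: complex_eq_iff)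
    moreover have "cmod (of_real t - z) \<le> t" using norm_le_of_mem_spectrum[OF z] assms(2) by simp
    then have "t - Re z \<le> t" using complex_Re_le_cmod[of "of_real t - z"] by simp
    ultimately show ?thesis by (metis atLeast_iff imageI le_diff_eq diff_le_eq add_0 add_le_same_cancel1 le_add_same_cancel1)
  qed
  then show ?thesis using assms by (auto simp: cstar_positive_def selfadjoint_simps)
qed

lemma le_norm: "cstar_selfadjoint a \<Longrightarrow> norm a \<le> t \<Longrightarrow> a \<le>\<^sub>* t *\<^sub>R 1"
  for a :: "'a::cstar_algebra"
  by (simp add: cstar_le_def positive_norm_minus selfadjoint_simps)

lemma norm_le_of_le:
  assumes "- t *\<^sub>R 1 \<le>\<^sub>* a" "a \<le>\<^sub>* t *\<^sub>R (1::'a::cstar_algebra)" "t \<ge> 0" shows "norm a \<le> t"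
proof (rule norm_selfadjoint_le)
  show sa: "cstar_selfadjoint a" using assms by (simp add: cstar_le_def)
  fix z assume z: "z \<in> cstar_spectrum a"
  have "of_real t - z \<in> cstar_spectrum (t *\<^sub>R 1 - a)" "of_real t + z \<in> cstar_spectrum (t *\<^sub>R 1 + a)"
    using z spectrum_shift_minus[of "of_real t" z a] spectrum_shift[of "of_real t" z a]
    by (simp_all add: scaleR_scaleC)
  then have "of_real t - z \<in> complex_of_real ` {0..}" "of_real t + z \<in> complex_of_real ` {0..}"
    using assms by (auto simp: cstar_le_def cstar_positive_def add.commute)
  then have "t - Re z \<ge> 0" "t + Re z \<ge> 0" by (auto simp: complex_eq_iff)
  moreover have "z = of_real (Re z)"
    using spectrum_of_selfadjoint_real[OF sa z] by (simp add: complex_eq_iff)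
  then have "cmod z = \<bar>Re z\<bar>" by (metis norm_of_real)
  ultimately show "cmod z \<le> t" by linarith
qed fact

section \<open>Continuous functional calculus\<close>

text \<open>Horner's scheme, with complex coefficients acting by \<open>*\<^sub>C\<close> on an
  argument from a possibly noncommutative algebra.\<close>

definition peval :: "complex poly \<Rightarrow> 'a::cstar_algebra \<Rightarrow> 'a"
  where "peval p a = fold_coeffs (\<lambda>c b. c *\<^sub>C 1 + a * b) p 0"

lemma peval_0 [simp]: "peval 0 a = 0"
  by (simp add: peval_def)

lemma peval_pCons [simp]: "peval (pCons c p) a = c *\<^sub>C 1 + a * peval p a"
  by (cases "p = 0 \<and> c = 0") (auto simp: peval_def)

lemma peval_add: "peval (p + q) a = peval p a + peval q a"
  by (induction p q rule: poly_induct2) (simp_all add: scaleC_simps algebra_simps)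

lemma peval_smult: "peval (smult c p) a = c *\<^sub>C peval p a"
  by (induction p) (simp_all add: scaleC_simps)

lemma peval_diff: "peval (p - q) a = peval p a - peval q a"
  using peval_add[of "p - q" q a] by simp

lemma peval_mult: "peval (p * q) a = peval p a * peval q a"
  by (induction p) (simp_all add: peval_add peval_smult scaleC_simps algebra_simps)

lemma peval_commute: "a * peval p a = peval p a * a"
proof (induction p)
  case (pCons c p)
  then have "a * (a * peval p a) = a * peval p a * a" by (metis mult.assoc)
  then show ?case
    by (simp only: peval_pCons distrib_left distrib_right mult_scaleC_left mult_scaleC_right mult_1 mult_1_right)
qed simp

lemma star_peval: "star (peval p a) = peval (map_poly cnj p) (star a)"
  by (induction p) (simp_all add: star_simps map_poly_pCons peval_commute)

text \<open>The fundamental theorem of algebra splits \<open>p\<close> into linear factors, each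
  invertible at \<open>a\<close> because its root avoids the spectrum.\<close>

lemma is_inverse_peval:
  assumes "p \<noteq> 0" "\<And>z. poly p z = 0 \<Longrightarrow> z \<notin> cstar_spectrum a"
  shows "\<exists>b. is_inverse (peval p a) b"
  using assms
proof (induction "degree p" arbitrary: p)
  case 0
  then obtain c where p: "p = [:c:]" "c \<noteq> 0" by (metis degree_eq_zeroE pCons_0_0)
  have "is_inverse (c *\<^sub>C 1) (inverse c *\<^sub>C (1::'a))"
    using is_inverse_scaleC[of 1 1 c] p by (simp add: is_inverse_def)
  with p show ?case by auto
next
  case (Suc n)
  then have "\<not> constant (poly p)" by (simp add: constant_degree)
  then obtain z where z: "poly p z = 0" using fundamental_theorem_of_algebra by blast
  then obtain q where q: "p = [:- z, 1:] * q" by (auto simp: poly_eq_0_iff_dvd dvd_def)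
  with Suc.prems have "q \<noteq> 0" by auto
  then have "degree p = Suc (degree q)" unfolding q by (subst degree_mult_eq) auto
  moreover have "\<And>w. poly q w = 0 \<Longrightarrow> w \<notin> cstar_spectrum a" using Suc.prems(2) q by simp
  ultimately obtain b where b: "is_inverse (peval q a) b"
    using Suc.hyps \<open>q \<noteq> 0\<close> by fastforce
  obtain c where "is_inverse (z *\<^sub>C 1 - a) c"
    using Suc.prems(2)[OF z] by (auto simp: spectrum_iff)
  then have "is_inverse (peval [:- z, 1:] a) (- c)"
    using is_inverse_minus[of "z *\<^sub>C 1 - a" c] by (simp add: scaleC_minus_left)
  from is_inverse_mult[OF this b] show ?case unfolding q peval_mult by blast
qed

text \<open>With an empty spectrum the spectral radius bound would force \<open>a = 0\<close>, whose
  spectrum contains 0. This replaces the usual appeal to Liouville's theorem.\<close>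

lemma spectrum_nonempty:
  assumes "cstar_selfadjoint (a::'a::cstar_algebra)" shows "cstar_spectrum a \<noteq> {}"
proof
  assume e: "cstar_spectrum a = {}"
  have "norm a \<le> 0" by (rule norm_selfadjoint_le[OF assms]) (simp_all add: e)
  then have "0 \<in> cstar_spectrum a" by (simp add: spectrum_iff is_inverse_def)
  with e show False by simp
qed

lemma spectrum_peval:
  assumes "z \<in> cstar_spectrum (peval p a)" "cstar_selfadjoint a"
  shows "\<exists>t\<in>cstar_spectrum a. z = poly p t"
proof (rule ccontr)
  assume n: "\<not> ?thesis"
  let ?q = "[:z:] - p"
  \<comment> \<open>If \<open>p\<close> were the constant \<open>z\<close>, any point of the
    nonempty spectrum would serve as \<open>t\<close>.\<close>
  have "?q \<noteq> 0" using n spectrum_nonempty[OF assms(2)] by auto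
  then obtain b where "is_inverse (peval ?q a) b"
    using is_inverse_peval[of ?q a] n by auto
  moreover have "peval ?q a = z *\<^sub>C 1 - peval p a" by (simp add: peval_diff)
  ultimately show False using assms(1) by (auto simp: spectrum_iff)
qed

text \<open>The value \<open>b\<close> of \<open>p\<close> at \<open>a\<close> need not be
  self-adjoint, but \<open>star b * b\<close> is, and it is again a polynomial in \<open>a\<close>.
  On the real spectrum that polynomial takes the values
  \<open>(cmod (poly p t))\<^sup>2\<close>.\<close>

lemma norm_peval_le:
  assumes a: "cstar_selfadjoint (a::'a::cstar_algebra)" and r: "r \<ge> 0"
    and p: "\<And>z. z \<in> cstar_spectrum a \<Longrightarrow> cmod (poly p z) \<le> r"
  shows "norm (peval p a) \<le> r"
proof -
  let ?b = "peval p a"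
  have star: "star ?b * ?b = peval (map_poly cnj p * p) a"
    using a by (simp add: star_peval peval_mult cstar_selfadjoint_def)
  have "norm (star ?b * ?b) \<le> r\<^sup>2"
  proof (rule norm_selfadjoint_le)
    fix z assume "z \<in> cstar_spectrum (star ?b * ?b)"
    then obtain t where t: "t \<in> cstar_spectrum a" "z = poly (map_poly cnj p * p) t"
      unfolding star using spectrum_peval[OF _ a] by blast
    have "cnj t = t" using spectrum_of_selfadjoint_real[OF a t(1)] by (simp add: complex_eq_iff)
    then have "poly (map_poly cnj p) t = cnj (poly p t)" by (metis poly_cnj)
    then have "z = cnj (poly p t) * poly p t" unfolding t(2) poly_mult by (rule arg_cong)
    then have "cmod z = (cmod (poly p t))\<^sup>2" by (simp add: norm_mult power2_eq_square)
    then show "cmod z \<le> r\<^sup>2" using p[OF t(1)] by (simp add: power_mono)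
  qed (simp_all add: selfadjoint_simps)
  then show ?thesis unfolding cstar_identity using r by (rule power2_le_imp_le)
qed

lemma real_polynomial_approx:
  fixes f :: "real \<Rightarrow> real"
  assumes "compact S" "continuous_on S f" "0 < e"
  obtains c n where "\<And>x. x \<in> S \<Longrightarrow> \<bar>f x - (\<Sum>i\<le>n. c i * x ^ i)\<bar> < e"
proof -
  obtain g where g: "real_polynomial_function g" "\<And>x. x \<in> S \<Longrightarrow> \<bar>f x - g x\<bar> < e"
    using Stone_Weierstrass_real_polynomial_function[OF assms] by blast
  then obtain c n where "g = (\<lambda>x. \<Sum>i\<le>n. c i * x ^ i)"
    unfolding real_polynomial_function_iff_sum by blast
  with g(2) show ?thesis by (intro that) simp
qed

text \<open>On the real axis a polynomial in \<open>Re z\<close> is a polynomial in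
  \<open>z\<close>, so Weierstrass approximation in one real variable applies.\<close>

lemma complex_polynomial_approx_real:
  fixes f :: "complex \<Rightarrow> real"
  assumes K: "compact K" "\<And>z. z \<in> K \<Longrightarrow> Im z = 0" and f: "continuous_on K f" and e: "e > 0"
  shows "\<exists>p. \<forall>z\<in>K. cmod (complex_of_real (f z) - poly p z) < e"
proof -
  have K': "complex_of_real (Re z) = z" if "z \<in> K" for z
    using K(2)[OF that] by (simp add: complex_eq_iff)
  have "continuous_on (Re ` K) (\<lambda>t. f (complex_of_real t))"
    by (rule continuous_on_compose2[OF f]) (auto simp: K' intro!: continuous_intros)
  moreover have "compact (Re ` K)" by (intro compact_continuous_image continuous_intros K)
  ultimately obtain c n where
    c: "\<And>x. x \<in> Re ` K \<Longrightarrow> \<bar>f (complex_of_real x) - (\<Sum>i\<le>n. c i * x ^ i)\<bar> < e"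
    using real_polynomial_approx[OF _ _ e] by blast
  let ?p = "\<Sum>i\<le>n. monom (complex_of_real (c i)) i"
  have "cmod (complex_of_real (f z) - poly ?p z) < e" if z: "z \<in> K" for z
  proof -
    have "poly ?p z = (\<Sum>i\<le>n. complex_of_real (c i) * complex_of_real (Re z) ^ i)"
      using K'[OF z] by (simp add: poly_sum poly_monom)
    then have "complex_of_real (f z) - poly ?p z = complex_of_real (f z - (\<Sum>i\<le>n. c i * Re z ^ i))"
      by simp
    then show ?thesis using c[of "Re z"] K'[OF z] z by (simp only: norm_of_real imageI)
  qed
  then show ?thesis by blast
qed

lemma complex_polynomial_approx:
  fixes f :: "complex \<Rightarrow> complex"
  assumes K: "compact K" "\<And>z. z \<in> K \<Longrightarrow> Im z = 0" and f: "continuous_on K f" and e: "e > 0"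
  shows "\<exists>p. \<forall>z\<in>K. cmod (f z - poly p z) < e"
proof -
  have c: "continuous_on K (\<lambda>z. Re (f z))" "continuous_on K (\<lambda>z. Im (f z))"
    by (intro continuous_intros f)+
  obtain p where p: "\<forall>z\<in>K. cmod (complex_of_real (Re (f z)) - poly p z) < e/2"
    using complex_polynomial_approx_real[OF K c(1), of "e/2"] e by auto
  obtain q where q: "\<forall>z\<in>K. cmod (complex_of_real (Im (f z)) - poly q z) < e/2"
    using complex_polynomial_approx_real[OF K c(2), of "e/2"] e by auto
  have "cmod (f z - poly (p + smult \<i> q) z) < e" if "z \<in> K" for z
  proof -
    have "f z - poly (p + smult \<i> q) z =
        (complex_of_real (Re (f z)) - poly p z) + \<i> * (complex_of_real (Im (f z)) - poly q z)"
      using complex_eq[of "f z"] by (simp add: algebra_simps)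
    also have "cmod \<dots> \<le> cmod (complex_of_real (Re (f z)) - poly p z)
        + cmod (complex_of_real (Im (f z)) - poly q z)"
      using norm_triangle_ineq[of "complex_of_real (Re (f z)) - poly p z"
          "\<i> * (complex_of_real (Im (f z)) - poly q z)"] by (simp add: norm_mult)
    also have "\<dots> < e" using p q that by fastforce
    finally show ?thesis .
  qed
  then show ?thesis by blast
qed

lemma polynomial_uniform_limit:
  fixes f :: "complex \<Rightarrow> complex"
  assumes "compact K" "\<And>z. z \<in> K \<Longrightarrow> Im z = 0" "continuous_on K f"
  obtains p where "uniform_limit K (\<lambda>n. poly (p n)) f sequentially"
proof -
  have "\<forall>n. \<exists>p. \<forall>z\<in>K. cmod (f z - poly p z) < inverse (real (Suc n))"
    using complex_polynomial_approx[OF assms] by simp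
  then obtain p where p: "\<And>n z. z \<in> K \<Longrightarrow> cmod (f z - poly (p n) z) < inverse (real (Suc n))"
    by metis
  have "uniform_limit K (\<lambda>n. poly (p n)) f sequentially"
  proof (rule uniform_limitI)
    fix e :: real assume "e > 0"
    then have "eventually (\<lambda>n. inverse (real (Suc n)) < e) sequentially"
      using LIMSEQ_inverse_real_of_nat by (rule order_tendstoD(2)[rotated])
    then show "eventually (\<lambda>n. \<forall>z\<in>K. dist (poly (p n) z) (f z) < e) sequentially"
    proof eventually_elim
      case (elim n)
      then show ?case using p[of _ n] by (force simp: dist_norm norm_minus_commute)
    qed
  qed
  then show ?thesis by (rule that)
qed

section \<open>Functional calculus as a limit of polynomials\<close>

lemma peval_tendsto_0:
  assumes a: "cstar_selfadjoint (a::'a::cstar_algebra)"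
    and p: "uniform_limit (cstar_spectrum a) (\<lambda>n. poly (p n)) (\<lambda>_. 0) F"
  shows "((\<lambda>n. peval (p n) a) \<longlongrightarrow> 0) F"
proof (rule tendstoI)
  fix e :: real assume "e > 0"
  then have "eventually (\<lambda>n. \<forall>z\<in>cstar_spectrum a. cmod (poly (p n) z) < e/2) F"
    using uniform_limitD[OF p, of "e/2"] by simp
  then show "eventually (\<lambda>n. dist (peval (p n) a) 0 < e) F"
  proof eventually_elim
    case (elim n)
    then have "norm (peval (p n) a) \<le> e/2"
      using \<open>e > 0\<close> by (intro norm_peval_le a) (auto simp: less_imp_le)
    then show ?case using \<open>e > 0\<close> by simp
  qed
qed

text \<open>The arbitrary choice of approximating polynomials is harmless: for self-adjoint
  \<open>a\<close> every such sequence has the same limit, by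
  \<open>peval_tendsto_cfc_limit\<close>.\<close>

definition cfc_limit :: "(complex \<Rightarrow> complex) \<Rightarrow> 'a::cstar_algebra \<Rightarrow> 'a"
  where "cfc_limit f a = lim (\<lambda>n. peval
    ((SOME p. uniform_limit (cstar_spectrum a) (\<lambda>n. poly (p n)) f sequentially) n) a)"

lemma peval_convergent:
  assumes a: "cstar_selfadjoint (a::'a::cstar_algebra)"
    and p: "uniform_limit (cstar_spectrum a) (\<lambda>n. poly (p n)) f sequentially"
  shows "convergent (\<lambda>n. peval (p n) a)"
proof -
  have "uniformly_Cauchy_on (cstar_spectrum a) (\<lambda>n. poly (p n))"
    using p uniformly_convergent_Cauchy unfolding uniformly_convergent_on_def by blast
  then have c: "\<exists>M. \<forall>z\<in>cstar_spectrum a. \<forall>m\<ge>M. \<forall>n\<ge>M. dist (poly (p m) z) (poly (p n) z) < e"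
    if "e > 0" for e using that unfolding uniformly_Cauchy_on_def by blast
  have "Cauchy (\<lambda>n. peval (p n) a)"
  proof (rule metric_CauchyI)
    fix e :: real assume e: "e > 0"
    then obtain M where M: "\<And>z m n. z \<in> cstar_spectrum a \<Longrightarrow> m \<ge> M \<Longrightarrow> n \<ge> M \<Longrightarrow>
        dist (poly (p m) z) (poly (p n) z) < e/2"
      using c[of "e/2"] by auto
    have "dist (peval (p m) a) (peval (p n) a) < e" if "m \<ge> M" "n \<ge> M" for m n
    proof -
      have "norm (peval (p m - p n) a) \<le> e/2"
        using M that e by (intro norm_peval_le a) (auto simp: dist_norm less_imp_le)
      then show ?thesis using e by (simp add: dist_norm peval_diff)
    qed
    then show "\<exists>M. \<forall>m\<ge>M. \<forall>n\<ge>M. dist (peval (p m) a) (peval (p n) a) < e" by blast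
  qed
  then show ?thesis by (simp add: Cauchy_convergent_iff)
qed

lemma peval_tendsto_cfc_limit:
  assumes a: "cstar_selfadjoint (a::'a::cstar_algebra)"
    and p: "uniform_limit (cstar_spectrum a) (\<lambda>n. poly (p n)) f sequentially"
  shows "(\<lambda>n. peval (p n) a) \<longlonglongrightarrow> cfc_limit f a"
proof -
  define q where "q = (SOME p. uniform_limit (cstar_spectrum a) (\<lambda>n. poly (p n)) f sequentially)"
  have q: "uniform_limit (cstar_spectrum a) (\<lambda>n. poly (q n)) f sequentially"
    using someI_ex[of "\<lambda>p. uniform_limit (cstar_spectrum a) (\<lambda>n. poly (p n)) f sequentially"] p
    unfolding q_def by blast
  have 1: "(\<lambda>n. peval (q n) a) \<longlonglongrightarrow> cfc_limit f a"
    using peval_convergent[OF a q] unfolding cfc_limit_def q_def by (simp add: convergent_LIMSEQ_iff)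
  have "uniform_limit (cstar_spectrum a) (\<lambda>n. poly (p n - q n)) (\<lambda>_. 0) sequentially"
    using uniform_limit_minus[OF p q] by (simp add: uniform_limit_iff)
  from peval_tendsto_0[OF a this] have "(\<lambda>n. peval (p n) a - peval (q n) a) \<longlonglongrightarrow> 0"
    by (simp add: peval_diff)
  from tendsto_add[OF this 1] show ?thesis by simp
qed

text \<open>Each law holds for the approximating polynomials and passes to the limit. For products,
  uniform convergence uses that continuous functions are bounded on the compact spectrum; for
  conjugation, that the spectrum is real, so conjugating the coefficients conjugates the
  values.\<close>

lemma cfc_limit_hom:
  assumes a: "cstar_selfadjoint (a::'a::cstar_algebra)"
  shows "cstar_cfc_hom a (\<lambda>f. cfc_limit f a)"
proof -
  let ?K = "cstar_spectrum a"
  have real: "Im z = 0" if "z \<in> ?K" for z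
    using spectrum_of_selfadjoint_real[OF a that] .
  have bdd: "bounded (f ` ?K)" if "continuous_on ?K f" for f :: "complex \<Rightarrow> complex"
    using that compact_spectrum by (intro compact_imp_bounded compact_continuous_image)
  obtain pf where pf: "\<And>f. continuous_on ?K f \<Longrightarrow> uniform_limit ?K (\<lambda>n. poly (pf f n)) f sequentially"
    using polynomial_uniform_limit[OF compact_spectrum real] by metis
  have lim: "cfc_limit f a = b"
    if "uniform_limit ?K (\<lambda>n. poly (p n)) f sequentially" "(\<lambda>n. peval (p n) a) \<longlonglongrightarrow> b" for f p b
    using peval_tendsto_cfc_limit[OF a that(1)] that(2) LIMSEQ_unique by blast
  have poly: "poly (p + q) = (\<lambda>z. poly p z + poly q z)" "poly (p * q) = (\<lambda>z. poly p z * poly q z)"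
    "poly (smult c p) = (\<lambda>z. c * poly p z)" "poly [:1:] = (\<lambda>z. 1::complex)" "poly [:0, 1:] = (\<lambda>z. z::complex)"
    for p q and c :: complex by (auto simp: fun_eq_iff)
  show ?thesis
    unfolding cstar_cfc_hom_def
  proof (intro conjI allI impI)
    fix f g :: "complex \<Rightarrow> complex"
    assume f: "continuous_on ?K f" and "\<forall>z\<in>?K. f z = g z"
    then have "uniform_limit ?K (\<lambda>n. poly (pf f n)) g sequentially"
      using pf[OF f] by (simp add: uniform_limit_iff)
    then show "cfc_limit f a = cfc_limit g a"
      using lim[of "pf f" g] peval_tendsto_cfc_limit[OF a pf[OF f]] by simp
  next
    fix f g :: "complex \<Rightarrow> complex"
    assume f: "continuous_on ?K f" and g: "continuous_on ?K g"
    note F = peval_tendsto_cfc_limit[OF a pf[OF f]] and G = peval_tendsto_cfc_limit[OF a pf[OF g]]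
    show "cfc_limit (\<lambda>z. f z + g z) a = cfc_limit f a + cfc_limit g a"
      using uniform_limit_add[OF pf[OF f] pf[OF g]] tendsto_add[OF F G]
      by (intro lim[where p = "\<lambda>n. pf f n + pf g n"]) (simp_all add: poly peval_add)
    show "cfc_limit (\<lambda>z. f z * g z) a = cfc_limit f a * cfc_limit g a"
      using uniform_lim_mult[OF pf[OF f] pf[OF g] bdd[OF f] bdd[OF g]] tendsto_mult[OF F G]
      by (intro lim[where p = "\<lambda>n. pf f n * pf g n"]) (simp_all add: poly peval_mult)
  next
    fix c and f :: "complex \<Rightarrow> complex" assume f: "continuous_on ?K f"
    note F = peval_tendsto_cfc_limit[OF a pf[OF f]]
    have "uniform_limit ?K (\<lambda>n z. c * poly (pf f n) z) (\<lambda>z. c * f z) sequentially"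
      by (intro bounded_linear.uniform_limit[OF bounded_linear_mult_right] pf f)
    then show "cfc_limit (\<lambda>z. c * f z) a = c *\<^sub>C cfc_limit f a"
      using tendsto_scaleC[OF F, of c]
      by (intro lim[where p = "\<lambda>n. smult c (pf f n)"]) (simp_all add: poly peval_smult)
  next
    fix f :: "complex \<Rightarrow> complex" assume f: "continuous_on ?K f"
    note F = peval_tendsto_cfc_limit[OF a pf[OF f]]
    have "uniform_limit ?K (\<lambda>n z. cnj (poly (pf f n) z)) (\<lambda>z. cnj (f z)) sequentially"
      by (intro bounded_linear.uniform_limit[OF bounded_linear_cnj] pf f)
    moreover have "cnj z = z" if "z \<in> ?K" for z using real[OF that] by (simp add: complex_eq_iff)
    then have "poly (map_poly cnj (pf f n)) z = cnj (poly (pf f n) z)" if "z \<in> ?K" for n z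
      using that by (metis poly_cnj)
    ultimately have "uniform_limit ?K (\<lambda>n. poly (map_poly cnj (pf f n))) (\<lambda>z. cnj (f z)) sequentially"
      by (simp add: uniform_limit_iff)
    then show "cfc_limit (\<lambda>z. cnj (f z)) a = star (cfc_limit f a)"
      using tendsto_star[OF F] a
      by (intro lim[where p = "\<lambda>n. map_poly cnj (pf f n)"])
        (simp_all add: star_peval cstar_selfadjoint_def)
  next
    show "cfc_limit (\<lambda>z. 1) a = 1"
      by (rule lim[where p = "\<lambda>n. [:1:]"]) (simp_all add: poly uniform_limit_const del: poly_pCons)
  next
    show "cfc_limit (\<lambda>z. z) a = a"
      by (rule lim[where p = "\<lambda>n. [:0, 1:]"]) (simp_all add: poly uniform_limit_const del: poly_pCons)
  qed
qed

text \<open>An arbitrary homomorphism, with no continuity assumed. Its contractivity is derived from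
  algebra and forces it to agree with \<open>cfc_limit\<close>; this uniqueness gives the definite
  description in \<open>cstar_cfc\<close> a meaning.\<close>

locale cfc_hom =
  fixes a :: "'a::cstar_algebra" and \<phi>
  assumes selfadjoint: "cstar_selfadjoint a" and hom: "cstar_cfc_hom a \<phi>"
begin

abbreviation "K \<equiv> cstar_spectrum a"

lemma hom_cong: "continuous_on K f \<Longrightarrow> (\<And>z. z \<in> K \<Longrightarrow> f z = g z) \<Longrightarrow> \<phi> f = \<phi> g"
  using hom unfolding cstar_cfc_hom_def by blast

lemma hom_add: "continuous_on K f \<Longrightarrow> continuous_on K g \<Longrightarrow> \<phi> (\<lambda>z. f z + g z) = \<phi> f + \<phi> g"
  and hom_mult: "continuous_on K f \<Longrightarrow> continuous_on K g \<Longrightarrow> \<phi> (\<lambda>z. f z * g z) = \<phi> f * \<phi> g"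
  and hom_scale: "continuous_on K f \<Longrightarrow> \<phi> (\<lambda>z. c * f z) = c *\<^sub>C \<phi> f"
  and hom_cnj: "continuous_on K f \<Longrightarrow> \<phi> (\<lambda>z. cnj (f z)) = star (\<phi> f)"
  and hom_one: "\<phi> (\<lambda>z. 1) = 1"
  and hom_id: "\<phi> (\<lambda>z. z) = a"
  using hom unfolding cstar_cfc_hom_def by blast+

lemma hom_const: "\<phi> (\<lambda>z. c) = c *\<^sub>C 1"
  using hom_scale[of "\<lambda>z. 1" c] hom_one by simp

lemma hom_diff:
  assumes "continuous_on K f" "continuous_on K g"
  shows "\<phi> (\<lambda>z. f z - g z) = \<phi> f - \<phi> g"
  using hom_add[OF assms(1) continuous_on_mult_left[OF assms(2), of "-1"]] hom_scale[OF assms(2), of "-1"]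
  by (simp add: scaleC_minus_left)

lemma hom_poly: "\<phi> (poly p) = peval p a"
proof (induction p)
  case 0
  then show ?case using hom_const[of 0] by (simp add: poly_0 [abs_def])
next
  case (pCons c p)
  have "\<phi> (poly (pCons c p)) = \<phi> (\<lambda>z. c + z * poly p z)"
    by (rule arg_cong[of _ _ \<phi>]) auto
  also have "\<dots> = \<phi> (\<lambda>z. c) + \<phi> (\<lambda>z. z) * \<phi> (poly p)"
    by (subst hom_add hom_mult, (intro continuous_intros)+)+ (rule refl)
  finally show ?case by (simp only: pCons hom_const hom_id peval_pCons)
qed

text \<open>If \<open>f\<close> omits the value \<open>z\<close> on the spectrum, then
  \<open>1 / (z - f)\<close> is continuous there and its image inverts
  \<open>z - \<phi> f\<close>.\<close>

lemma hom_spectrum: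
  assumes f: "continuous_on K f" and z: "z \<in> cstar_spectrum (\<phi> f)" shows "z \<in> f ` K"
proof (rule ccontr)
  assume n: "z \<notin> f ` K"
  let ?g = "\<lambda>t. inverse (z - f t)"
  have nz: "z - f t \<noteq> 0" if "t \<in> K" for t using n that by auto
  have g: "continuous_on K ?g" "continuous_on K (\<lambda>t. z - f t)"
    using nz by (auto intro!: continuous_intros f)
  have "\<phi> (\<lambda>t. (z - f t) * ?g t) = \<phi> (\<lambda>t. 1)" "\<phi> (\<lambda>t. ?g t * (z - f t)) = \<phi> (\<lambda>t. 1)"
    using nz by (auto intro!: hom_cong continuous_on_mult g)
  moreover have "\<phi> (\<lambda>t. z - f t) = z *\<^sub>C 1 - \<phi> f"
    using hom_diff[OF continuous_on_const f, of z] by (simp only: hom_const)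
  ultimately have "is_inverse (z *\<^sub>C 1 - \<phi> f) (\<phi> ?g)"
    unfolding is_inverse_def by (simp only: hom_mult[OF g(2,1)] hom_mult[OF g] hom_one)
  with z show False by (auto simp: spectrum_iff)
qed

text \<open>Automatic contractivity: the C*-identity passes to the function
  \<open>cnj f * f\<close>, and \<open>hom_spectrum\<close> bounds the spectrum of its
  image.\<close>

lemma hom_norm_le:
  assumes f: "continuous_on K f" and r: "r \<ge> 0" "\<And>z. z \<in> K \<Longrightarrow> cmod (f z) \<le> r"
  shows "norm (\<phi> f) \<le> r"
proof -
  have c: "continuous_on K (\<lambda>z. cnj (f z))" by (intro continuous_intros f)
  have s: "star (\<phi> f) * \<phi> f = \<phi> (\<lambda>z. cnj (f z) * f z)" by (simp add: hom_mult f c hom_cnj)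
  have "norm (star (\<phi> f) * \<phi> f) \<le> r\<^sup>2"
  proof (rule norm_selfadjoint_le)
    fix z assume "z \<in> cstar_spectrum (star (\<phi> f) * \<phi> f)"
    then obtain t where t: "t \<in> K" "z = cnj (f t) * f t"
      using hom_spectrum[OF continuous_on_mult[OF c f]] s by auto
    then have "cmod z = (cmod (f t))\<^sup>2" by (simp add: norm_mult power2_eq_square)
    then show "cmod z \<le> r\<^sup>2" using r(2)[OF t(1)] by (simp add: power_mono)
  qed (simp_all add: selfadjoint_simps)
  then show ?thesis unfolding cstar_identity using r(1) by (rule power2_le_imp_le)
qed

lemma hom_tendsto:
  assumes f: "continuous_on K f" and g: "eventually (\<lambda>n. continuous_on K (g n)) F"
    and lim: "uniform_limit K g f F"
  shows "((\<lambda>n. \<phi> (g n)) \<longlongrightarrow> \<phi> f) F"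
proof (rule tendstoI)
  fix e :: real assume e: "e > 0"
  then have "eventually (\<lambda>n. \<forall>z\<in>K. dist (g n z) (f z) < e/2) F"
    using uniform_limitD[OF lim, of "e/2"] by simp
  then show "eventually (\<lambda>n. dist (\<phi> (g n)) (\<phi> f) < e) F"
    using g
  proof eventually_elim
    case (elim n)
    then have "norm (\<phi> (\<lambda>z. g n z - f z)) \<le> e/2"
      using e f by (intro hom_norm_le continuous_intros) (auto simp: dist_norm less_imp_le)
    then show ?case using e elim f by (simp add: hom_diff dist_norm)
  qed
qed

lemma hom_eq_cfc_limit:
  assumes f: "continuous_on K f" shows "\<phi> f = cfc_limit f a"
proof -
  have "Im z = 0" if "z \<in> K" for z using spectrum_of_selfadjoint_real[OF selfadjoint that] .
  then obtain p where p: "uniform_limit K (\<lambda>n. poly (p n)) f sequentially"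
    using polynomial_uniform_limit[OF compact_spectrum _ f] by metis
  have "(\<lambda>n. peval (p n) a) \<longlonglongrightarrow> \<phi> f"
    using hom_tendsto[OF f _ p] by (simp add: hom_poly continuous_intros)
  then show ?thesis
    using peval_tendsto_cfc_limit[OF selfadjoint p] LIMSEQ_unique by blast
qed

end

lemma cstar_cfc_eq_limit:
  assumes a: "cstar_selfadjoint (a::'a::cstar_algebra)" and f: "continuous_on (cstar_spectrum a) f"
  shows "cstar_cfc f a = cfc_limit f a"
  unfolding cstar_cfc_def
proof (rule the_equality)
  show "\<exists>\<phi>. cstar_cfc_hom a \<phi> \<and> \<phi> f = cfc_limit f a"
    using cfc_limit_hom[OF a] by blast
  show "b = cfc_limit f a" if "\<exists>\<phi>. cstar_cfc_hom a \<phi> \<and> \<phi> f = b" for b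
    using that cfc_hom.hom_eq_cfc_limit[OF cfc_hom.intro[OF a] f] by blast
qed

section \<open>Real functions of self-adjoint elements\<close>

definition rspec :: "'a::cstar_algebra \<Rightarrow> real set"
  where "rspec a = Re ` cstar_spectrum a"

definition rfc :: "(real \<Rightarrow> real) \<Rightarrow> 'a::cstar_algebra \<Rightarrow> 'a"
  where "rfc f a = cstar_cfc (\<lambda>z. complex_of_real (f (Re z))) a"

lemma compact_rspec: "compact (rspec a)"
  unfolding rspec_def by (intro compact_continuous_image compact_spectrum continuous_intros)

context
  fixes a :: "'a::cstar_algebra"
  assumes a: "cstar_selfadjoint a"
begin

interpretation cfc_hom a "\<lambda>f. cfc_limit f a"
  using a cfc_limit_hom by (simp add: cfc_hom_def)

lemma mem_rspec_iff: "t \<in> rspec a \<longleftrightarrow> complex_of_real t \<in> cstar_spectrum a"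
proof
  assume "t \<in> rspec a"
  then obtain z where z: "z \<in> cstar_spectrum a" "t = Re z" by (auto simp: rspec_def)
  then have "complex_of_real t = z" using spectrum_of_selfadjoint_real[OF a] by (simp add: complex_eq_iff)
  with z show "complex_of_real t \<in> cstar_spectrum a" by simp
qed (force simp: rspec_def)

lemma continuous_on_spectrum:
  "continuous_on (rspec a) f \<Longrightarrow> continuous_on (cstar_spectrum a) (\<lambda>z. complex_of_real (f (Re z)))"
  by (rule continuous_on_of_real, erule continuous_on_compose2)
    (auto simp: rspec_def intro: continuous_intros)

lemma rfc_eq: "continuous_on (rspec a) f \<Longrightarrow> rfc f a = cfc_limit (\<lambda>z. complex_of_real (f (Re z))) a"
  unfolding rfc_def by (intro cstar_cfc_eq_limit a continuous_on_spectrum)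

lemma rfc_cong:
  assumes "continuous_on (rspec a) f" "\<And>t. t \<in> rspec a \<Longrightarrow> f t = g t" shows "rfc f a = rfc g a"
proof -
  have "continuous_on (rspec a) g" using assms by (metis continuous_on_cong)
  then show ?thesis using assms
    by (auto simp: rfc_eq rspec_def intro!: hom_cong continuous_on_spectrum)
qed

lemma rfc_add:
  "continuous_on (rspec a) f \<Longrightarrow> continuous_on (rspec a) g \<Longrightarrow> rfc (\<lambda>t. f t + g t) a = rfc f a + rfc g a"
  using hom_add[OF continuous_on_spectrum[of f] continuous_on_spectrum[of g]]
  by (simp add: rfc_eq[of f] rfc_eq[of g] rfc_eq[of "\<lambda>t. f t + g t"] continuous_on_add)

lemma rfc_diff:
  "continuous_on (rspec a) f \<Longrightarrow> continuous_on (rspec a) g \<Longrightarrow> rfc (\<lambda>t. f t - g t) a = rfc f a - rfc g a"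
  using hom_diff[OF continuous_on_spectrum[of f] continuous_on_spectrum[of g]]
  by (simp add: rfc_eq[of f] rfc_eq[of g] rfc_eq[of "\<lambda>t. f t - g t"] continuous_on_diff)

lemma rfc_mult:
  "continuous_on (rspec a) f \<Longrightarrow> continuous_on (rspec a) g \<Longrightarrow> rfc (\<lambda>t. f t * g t) a = rfc f a * rfc g a"
  using hom_mult[OF continuous_on_spectrum[of f] continuous_on_spectrum[of g]]
  by (simp add: rfc_eq[of f] rfc_eq[of g] rfc_eq[of "\<lambda>t. f t * g t"] continuous_on_mult)

lemma rfc_scale: "continuous_on (rspec a) f \<Longrightarrow> rfc (\<lambda>t. c * f t) a = c *\<^sub>R rfc f a"
  using hom_scale[OF continuous_on_spectrum, of f "complex_of_real c"]
  by (simp add: rfc_eq[of f] rfc_eq[of "\<lambda>t. c * f t"] continuous_on_mult_left scaleR_scaleC)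

lemma rfc_const: "rfc (\<lambda>t. c) a = c *\<^sub>R 1"
  using hom_const[of "complex_of_real c"] by (simp add: rfc_eq[of "\<lambda>t. c"] scaleR_scaleC)

lemma rfc_id: "rfc (\<lambda>t. t) a = a"
proof -
  have "complex_of_real (Re z) = z" if "z \<in> cstar_spectrum a" for z
    using spectrum_of_selfadjoint_real[OF a that] by (simp add: complex_eq_iff)
  then show ?thesis
    using hom_cong[OF continuous_on_spectrum, of "\<lambda>t. t" "\<lambda>z. z"] hom_id
    by (simp add: rfc_eq)
qed

lemma selfadjoint_rfc: "continuous_on (rspec a) f \<Longrightarrow> cstar_selfadjoint (rfc f a)"
  using hom_cnj[OF continuous_on_spectrum, of f] by (simp add: rfc_eq[of f] cstar_selfadjoint_def)

lemma spectrum_rfc: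
  assumes "continuous_on (rspec a) f" "z \<in> cstar_spectrum (rfc f a)"
  obtains t where "t \<in> rspec a" "z = complex_of_real (f t)"
  using hom_spectrum[OF continuous_on_spectrum[OF assms(1)], of z] assms(2)
  unfolding rfc_eq[OF assms(1)] rspec_def by (blast intro: that[unfolded rspec_def])

lemma rspec_rfc: "continuous_on (rspec a) f \<Longrightarrow> rspec (rfc f a) \<subseteq> f ` rspec a"
proof
  fix t assume f: "continuous_on (rspec a) f" and "t \<in> rspec (rfc f a)"
  then obtain z where z: "z \<in> cstar_spectrum (rfc f a)" "t = Re z" by (auto simp: rspec_def)
  then obtain u where "u \<in> rspec a" "z = complex_of_real (f u)" using spectrum_rfc[OF f] by metis
  with z(2) show "t \<in> f ` rspec a" by simp
qed

lemma norm_rfc_le: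
  assumes "continuous_on (rspec a) f" "r \<ge> 0" "\<And>t. t \<in> rspec a \<Longrightarrow> \<bar>f t\<bar> \<le> r"
  shows "norm (rfc f a) \<le> r"
  unfolding rfc_eq[OF assms(1)]
  by (rule hom_norm_le[OF continuous_on_spectrum[OF assms(1)] assms(2)])
    (use assms(3) in \<open>simp add: rspec_def\<close>)

lemma positive_rfc:
  assumes "continuous_on (rspec a) f" "\<And>t. t \<in> rspec a \<Longrightarrow> f t \<ge> 0"
  shows "cstar_positive (rfc f a)"
  unfolding cstar_positive_def
  using selfadjoint_rfc[OF assms(1)] spectrum_rfc[OF assms(1)] assms(2) by blast

lemma rfc_mono:
  assumes "continuous_on (rspec a) f" "continuous_on (rspec a) g" "\<And>t. t \<in> rspec a \<Longrightarrow> f t \<le> g t"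
  shows "rfc f a \<le>\<^sub>* rfc g a"
  using positive_rfc[OF continuous_on_diff[OF assms(2,1)]] assms selfadjoint_rfc
  by (simp add: cstar_le_def rfc_diff)

lemma rfc_tendsto:
  assumes f: "continuous_on (rspec a) f" and g: "eventually (\<lambda>n. continuous_on (rspec a) (g n)) F"
    and lim: "uniform_limit (rspec a) g f F"
  shows "((\<lambda>n. rfc (g n) a) \<longlongrightarrow> rfc f a) F"
proof -
  have "((\<lambda>n. cfc_limit (\<lambda>z. complex_of_real (g n (Re z))) a) \<longlongrightarrow> rfc f a) F"
    unfolding rfc_eq[OF f]
  proof (rule hom_tendsto)
    show "uniform_limit (cstar_spectrum a) (\<lambda>n z. complex_of_real (g n (Re z)))
        (\<lambda>z. complex_of_real (f (Re z))) F"
      using lim by (simp add: uniform_limit_iff rspec_def dist_of_real)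
  qed (use f g continuous_on_spectrum in \<open>blast intro: eventually_mono\<close>)+
  then show ?thesis
    by (rule Lim_transform_eventually) (use g in \<open>auto elim!: eventually_mono simp: rfc_eq\<close>)
qed

lemma rfc_power: "continuous_on (rspec a) f \<Longrightarrow> rfc (\<lambda>t. f t ^ n) a = rfc f a ^ n"
proof (induction n)
  case 0
  then show ?case using rfc_const[of 1] by simp
next
  case (Suc n)
  then show ?case by (simp add: rfc_mult continuous_on_power)
qed

lemma rfc_sum:
  "(\<And>i. i \<in> I \<Longrightarrow> continuous_on (rspec a) (f i)) \<Longrightarrow> rfc (\<lambda>t. \<Sum>i\<in>I. f i t) a = (\<Sum>i\<in>I. rfc (f i) a)"
proof (induction I rule: infinite_finite_induct)
  case (insert i I)
  then show ?case by (simp add: rfc_add continuous_on_sum)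
qed (use rfc_const[of 0] in simp_all)

lemma rfc_polynomial:
  assumes "continuous_on (rspec a) f"
  shows "rfc (\<lambda>t. \<Sum>i\<le>n. c i * f t ^ i) a = (\<Sum>i\<le>n. c i *\<^sub>R rfc f a ^ i)"
  using assms by (subst rfc_sum) (auto intro!: continuous_intros simp: rfc_scale rfc_power continuous_on_power)

end

lemma rfc_compose:
  assumes a: "cstar_selfadjoint (a::'a::cstar_algebra)"
    and f: "continuous_on (rspec a) f" and g: "continuous_on (f ` rspec a) g"
  shows "rfc g (rfc f a) = rfc (\<lambda>t. g (f t)) a"
proof -
  let ?b = "rfc f a"
  have b: "cstar_selfadjoint ?b" using selfadjoint_rfc[OF a f] .
  have sub: "rspec ?b \<subseteq> f ` rspec a" using rspec_rfc[OF a f] .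
  then have gb: "continuous_on (rspec ?b) g" using g continuous_on_subset by blast
  have gf: "continuous_on (rspec a) (\<lambda>t. g (f t))" by (rule continuous_on_compose2[OF g f]) simp
  have "norm (rfc g ?b - rfc (\<lambda>t. g (f t)) a) \<le> e" if e: "e > 0" for e
  proof -
    have "compact (f ` rspec a)" by (intro compact_continuous_image f compact_rspec)
    then obtain c n where c: "\<And>x. x \<in> f ` rspec a \<Longrightarrow> \<bar>g x - (\<Sum>i\<le>n. c i * x ^ i)\<bar> < e/2"
      using real_polynomial_approx[OF _ g, of "e/2"] e by auto
    let ?h = "\<lambda>x. \<Sum>i\<le>n. c i * x ^ i"
    have hb: "continuous_on (rspec ?b) ?h" by (intro continuous_intros)
    have hf: "continuous_on (rspec a) (\<lambda>t. ?h (f t))" by (intro continuous_intros f)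
    have eq: "rfc ?h ?b = rfc (\<lambda>t. ?h (f t)) a"
      using rfc_polynomial[OF b, of "\<lambda>t. t"] rfc_polynomial[OF a f] rfc_id[OF b] by simp
    have "norm (rfc (\<lambda>x. g x - ?h x) ?b) \<le> e/2"
      using c sub e by (intro norm_rfc_le b continuous_on_diff gb hb) (auto simp: less_imp_le subset_iff)
    moreover have "norm (rfc (\<lambda>t. g (f t) - ?h (f t)) a) \<le> e/2"
      using c e by (intro norm_rfc_le a continuous_on_diff gf hf) (auto simp: less_imp_le)
    ultimately have 1: "norm (rfc g ?b - rfc ?h ?b) \<le> e/2"
      "norm (rfc (\<lambda>t. g (f t)) a - rfc ?h ?b) \<le> e/2"
      by (simp_all only: rfc_diff[OF b gb hb] rfc_diff[OF a gf hf] eq)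
    have "norm (rfc g ?b - rfc (\<lambda>t. g (f t)) a) \<le>
        norm (rfc g ?b - rfc ?h ?b) + norm (rfc (\<lambda>t. g (f t)) a - rfc ?h ?b)"
      using norm_triangle_ineq4[of "rfc g ?b - rfc ?h ?b" "rfc (\<lambda>t. g (f t)) a - rfc ?h ?b"] by simp
    then show ?thesis using 1 by linarith
  qed
  then have "norm (rfc g ?b - rfc (\<lambda>t. g (f t)) a) \<le> 0" by (rule field_le_epsilon) simp
  then show ?thesis by simp
qed

section \<open>Positivity of \<open>x\<^sup>*x\<close>, conjugation and order\<close>

lemma positive_square:
  assumes a: "cstar_selfadjoint (a::'a::cstar_algebra)" shows "cstar_positive (a * a)"
proof -
  have "rfc (\<lambda>t. t * t) a = a * a" by (simp add: rfc_mult[OF a] rfc_id[OF a])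
  then show ?thesis using positive_rfc[OF a, of "\<lambda>t. t * t"] by (simp add: continuous_intros)
qed

text \<open>\<open>h\<close> is twice the real part of \<open>z\<close> and \<open>k\<close> is
  minus twice its imaginary part; in the sum of their squares the mixed terms cancel.\<close>

lemma positive_star_mult_add:
  "cstar_positive (star z * z + z * star (z::'a::cstar_algebra))"
proof -
  define h where "h = z + star z"
  define k where "k = \<i> *\<^sub>C (z - star z)"
  have "cstar_selfadjoint h" "cstar_selfadjoint k"
    by (simp_all add: h_def k_def cstar_selfadjoint_def star_simps scaleC_simps add.commute)
  then have "cstar_positive ((1/2) *\<^sub>R (h * h + k * k))"
    by (intro positive_scaleR positive_add positive_square) auto
  moreover have "h * h + k * k = 2 *\<^sub>R (star z * z + z * star z)"
    by (simp add: h_def k_def scaleC_simps algebra_simps scaleR_2)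
  ultimately show ?thesis by simp
qed

text \<open>Kaplansky's argument. With \<open>c\<close> the negative part of
  \<open>y = star x * x\<close> and \<open>z = x * c\<close>, the element \<open>star z * z\<close>
  is minus the cube of \<open>c\<close>, hence negative. So is \<open>z * star z\<close>, having the
  same nonzero spectrum, while their sum is positive. Therefore \<open>star z * z\<close> vanishes,
  and with it \<open>c\<close>.\<close>

lemma positive_star_mult_self: "cstar_positive (star x * (x::'a::cstar_algebra))"
proof -
  define y where "y = star x * x"
  have y: "cstar_selfadjoint y" by (simp add: y_def selfadjoint_simps)
  define m where "m = (\<lambda>t::real. max 0 (- t))"
  have m: "continuous_on S m" for S unfolding m_def by (intro continuous_intros)
  define c where "c = rfc m y"
  have c: "cstar_selfadjoint c" unfolding c_def by (rule selfadjoint_rfc[OF y m])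
  define z where "z = x * c"
  have "star z * z = c * y * c"
    using c by (simp add: z_def y_def star_simps cstar_selfadjoint_def mult.assoc)
  also have "\<dots> = rfc (\<lambda>t. m t * t * m t) y"
    by (simp add: c_def rfc_mult[OF y] rfc_id[OF y] m continuous_intros)
  finally have zz: "star z * z = rfc (\<lambda>t. m t * t * m t) y" .
  have m3: "rfc (\<lambda>t. m t * t * m t) y = - (c * c * c)"
  proof -
    have "rfc (\<lambda>t. m t * t * m t) y = rfc (\<lambda>t. (-1) * (m t * m t * m t)) y"
      by (rule arg_cong[of _ _ "\<lambda>f. rfc f y"]) (auto simp: m_def max_def)
    also have "\<dots> = (-1) *\<^sub>R rfc (\<lambda>t. m t * m t * m t) y"
      by (rule rfc_scale[OF y]) (intro continuous_intros m)
    also have "rfc (\<lambda>t. m t * m t * m t) y = c * c * c"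
      by (simp add: c_def rfc_mult[OF y] m continuous_intros)
    finally show ?thesis by simp
  qed
  have neg: "cstar_positive (- (star z * z))"
  proof -
    have "c * c * c = rfc (\<lambda>t. m t * m t * m t) y"
      by (simp add: c_def rfc_mult[OF y] m continuous_intros)
    moreover have "cstar_positive (rfc (\<lambda>t. m t * m t * m t) y)"
      by (rule positive_rfc[OF y]) (auto intro!: continuous_intros m simp: m_def)
    ultimately show ?thesis by (simp add: zz m3)
  qed
  have "cstar_positive (- (z * star z))"
    unfolding cstar_positive_def
  proof (intro conjI subsetI)
    show "cstar_selfadjoint (- (z * star z))" by (simp add: selfadjoint_simps)
    fix w assume w: "w \<in> cstar_spectrum (- (z * star z))"
    show "w \<in> complex_of_real ` {0..}"
    proof (cases "w = 0")
      case False
      have "- w \<in> cstar_spectrum (z * star z)"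
        using w spectrum_minus[of w "- (z * star z)"] by simp
      then have "- w \<in> cstar_spectrum (star z * z)" using False spectrum_mult_commute by force
      then have "w \<in> cstar_spectrum (- (star z * z))" using spectrum_minus[of "-w"] by force
      then show ?thesis using neg by (auto simp: cstar_positive_def)
    qed (auto intro!: image_eqI[of _ _ 0])
  qed
  from positive_add[OF positive_star_mult_add[of z] this] have "cstar_positive (star z * z)" by simp
  from positive_antisym[OF this neg] have "c * c * c = 0" using zz m3 by simp
  \<comment> \<open>The fourth power allows the norm identity for squares of self-adjoint elements
    to be used twice.\<close>
  then have "(c * c) * (c * c) = 0" by (simp add: mult.assoc)
  moreover have "norm ((c * c) * (c * c)) = ((norm c)\<^sup>2)\<^sup>2"
    using c by (simp add: norm_selfadjoint_square cstar_selfadjoint_def star_mult)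
  ultimately have "c = 0" by simp
  have "(\<lambda>t. max 0 t - m t) = (\<lambda>t. t)" by (auto simp: m_def max_def)
  then have "y = rfc (\<lambda>t. max 0 t - m t) y" using rfc_id[OF y] by simp
  also have "\<dots> = rfc (\<lambda>t. max 0 t) y - c"
    unfolding c_def by (rule rfc_diff[OF y _ m]) (intro continuous_intros)
  finally have "y = rfc (\<lambda>t. max 0 t) y" using \<open>c = 0\<close> by simp
  moreover have "cstar_positive (rfc (\<lambda>t. max 0 t) y)"
    by (rule positive_rfc[OF y]) (auto intro!: continuous_intros)
  ultimately show ?thesis unfolding y_def by simp
qed

lemma rspec_positive: "cstar_positive a \<Longrightarrow> t \<in> rspec a \<Longrightarrow> 0 \<le> t"
  by (auto simp: cstar_positive_def rspec_def)

lemma positive_sqrt: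
  assumes a: "cstar_positive (a::'a::cstar_algebra)"
  obtains r where "cstar_selfadjoint r" "a = r * r"
proof -
  note sa = positive_selfadjoint[OF a]
  have c: "continuous_on (rspec a) sqrt" by (intro continuous_intros)
  have "rfc sqrt a * rfc sqrt a = rfc (\<lambda>t. sqrt t * sqrt t) a" by (rule rfc_mult[OF sa c c, symmetric])
  also have "\<dots> = rfc (\<lambda>t. t) a"
    using rspec_positive[OF a] by (intro rfc_cong[OF sa]) (auto intro!: continuous_intros)
  finally show ?thesis
    using that[of "rfc sqrt a"] selfadjoint_rfc[OF sa c] rfc_id[OF sa] by simp
qed

lemma positive_conj:
  assumes "cstar_positive (a::'a::cstar_algebra)" shows "cstar_positive (star c * a * c)"
proof -
  obtain r where "cstar_selfadjoint r" "a = r * r" using positive_sqrt[OF assms] .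
  then have "star c * a * c = star (r * c) * (r * c)"
    by (simp add: star_mult cstar_selfadjoint_def mult.assoc)
  then show ?thesis by (simp only: positive_star_mult_self)
qed

lemma le_conj:
  assumes "a \<le>\<^sub>* b" shows "star c * a * c \<le>\<^sub>* star c * b * c"
  using assms positive_conj[of "b - a" c] selfadjoint_conj[of a c] selfadjoint_conj[of b c]
  by (simp add: cstar_le_def algebra_simps)

lemma le_conj_selfadjoint: "cstar_selfadjoint c \<Longrightarrow> a \<le>\<^sub>* b \<Longrightarrow> c * a * c \<le>\<^sub>* c * b * c"
  using le_conj[of a b c] by (simp add: cstar_selfadjoint_def)

lemma positive_conj_selfadjoint:
  "cstar_selfadjoint c \<Longrightarrow> cstar_positive a \<Longrightarrow> cstar_positive (c * a * c)"
  using positive_conj[of a c] by (simp add: cstar_selfadjoint_def)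

lemma norm_le_of_positive_le:
  assumes "cstar_positive a" "a \<le>\<^sub>* t *\<^sub>R (1::'a::cstar_algebra)" "t \<ge> 0" shows "norm a \<le> t"
proof (rule norm_le_of_le)
  have "- t *\<^sub>R 1 \<le>\<^sub>* (0::'a)"
    using positive_scaleR[OF positive_one assms(3)]
    by (auto simp: cstar_le_def selfadjoint_simps)
  then show "- t *\<^sub>R 1 \<le>\<^sub>* a" using assms(1) positive_iff_le cstar_le_trans by blast
qed (use assms in auto)

lemma le_epsilon:
  assumes "\<And>e. e > 0 \<Longrightarrow> a \<le>\<^sub>* b + e *\<^sub>R (1::'a::cstar_algebra)"
  shows "a \<le>\<^sub>* b"
proof (rule tendsto_cstar_le)
  have "((\<lambda>e. b + e *\<^sub>R (1::'a)) \<longlongrightarrow> b + 0 *\<^sub>R 1) (at_right 0)"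
    by (intro tendsto_intros)
  then show "((\<lambda>e. b + e *\<^sub>R (1::'a)) \<longlongrightarrow> b) (at_right 0)" by simp
  show "eventually (\<lambda>e. a \<le>\<^sub>* b + e *\<^sub>R 1) (at_right 0)"
    using assms by (auto simp: eventually_at_filter)
qed (simp_all add: trivial_limit_at_right_real)

section \<open>Powers of positive elements\<close>

definition real_power :: "real \<Rightarrow> real \<Rightarrow> real"
  where "real_power p t = (if p = 0 then 1 else t powr p)"

lemma cstar_powr_eq_rfc: "cstar_powr a p = rfc (real_power p) a"
  by (simp add: cstar_powr_def rfc_def real_power_def)

lemma real_power_nonneg: "0 \<le> real_power p t"
  by (simp add: real_power_def)

lemma real_power_pos: "0 < t \<Longrightarrow> 0 < real_power p t"
  by (simp add: real_power_def)

lemma real_power_0 [simp]: "real_power 0 = (\<lambda>t. 1)"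
  by (simp add: real_power_def fun_eq_iff)

lemma real_power_1 [simp]: "0 \<le> t \<Longrightarrow> real_power 1 t = t"
  by (simp add: real_power_def)

lemma real_power_add:
  assumes "0 \<le> t" "t = 0 \<Longrightarrow> 0 \<le> p \<and> 0 \<le> q"
  shows "real_power (p + q) t = real_power p t * real_power q t"
proof (cases "t = 0")
  case True
  then show ?thesis using assms(2) by (auto simp: real_power_def add_nonneg_eq_0_iff)
next
  case False
  then have "real_power r t = t powr r" for r by (simp add: real_power_def)
  then show ?thesis by (simp add: powr_add)
qed

lemma real_power_mult:
  assumes "0 \<le> t" "t = 0 \<Longrightarrow> 0 \<le> p \<and> 0 \<le> q"
  shows "real_power q (real_power p t) = real_power (p * q) t"
proof (cases "t = 0")
  case True
  then show ?thesis using assms(2) by (auto simp: real_power_def)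
next
  case False
  then have "real_power r t = t powr r" "t powr r \<noteq> 0" for r by (simp_all add: real_power_def)
  then show ?thesis by (simp add: real_power_def powr_powr)
qed

lemma real_power_mono: "0 \<le> s \<Longrightarrow> s \<le> t \<Longrightarrow> 0 \<le> p \<Longrightarrow> real_power p s \<le> real_power p t"
  by (simp add: real_power_def powr_mono2)

lemma continuous_on_real_power:
  assumes "continuous_on S f" "\<And>x. x \<in> S \<Longrightarrow> 0 \<le> f x" "\<And>x. x \<in> S \<Longrightarrow> f x = 0 \<Longrightarrow> 0 \<le> p"
  shows "continuous_on S (\<lambda>x. real_power p (f x))"
proof (cases "p = 0")
  case False
  then have "continuous_on S (\<lambda>x. f x powr p)"
    using assms(2,3) by (intro continuous_on_powr' assms(1) continuous_on_const) fastforce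
  then show ?thesis using False by (simp add: real_power_def)
qed simp

text \<open>For negative \<open>p\<close> the function \<open>t powr p\<close> need not be
  continuous at \<open>t = 0\<close>, where HOL gives it the value 0. Admitting such exponents for
  invertible elements lets the laws of exponents cover inverses and inverse roots.\<close>

definition power_defined :: "'a::cstar_algebra \<Rightarrow> real \<Rightarrow> bool"
  where "power_defined a p \<longleftrightarrow> cstar_positive a \<and> (0 \<le> p \<or> 0 \<notin> cstar_spectrum a)"

lemma power_defined_nonneg: "cstar_positive a \<Longrightarrow> 0 \<le> p \<Longrightarrow> power_defined a p"
  by (simp add: power_defined_def)

lemma power_defined_positive: "power_defined a p \<Longrightarrow> cstar_positive a"
  by (simp add: power_defined_def)

lemma zero_rspec: "cstar_selfadjoint a \<Longrightarrow> 0 \<in> rspec a \<longleftrightarrow> 0 \<in> cstar_spectrum a"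
  using mem_rspec_iff[of a 0] by simp

lemma power_defined_rspec:
  assumes "power_defined a p" "t \<in> rspec a" shows "0 \<le> t" "t = 0 \<Longrightarrow> 0 \<le> p"
proof -
  show "0 \<le> t" using assms rspec_positive by (auto simp: power_defined_def)
  show "0 \<le> p" if "t = 0"
    using assms that zero_rspec[OF positive_selfadjoint] by (auto simp: power_defined_def)
qed

lemma continuous_on_rspec_power:
  assumes "power_defined a p" shows "continuous_on (rspec a) (real_power p)"
  by (rule continuous_on_real_power[OF continuous_on_id]) (rule power_defined_rspec[OF assms], assumption+)+

lemma positive_powr:
  assumes "power_defined a p" shows "cstar_positive (cstar_powr a p)"
  unfolding cstar_powr_eq_rfc
  by (intro positive_rfc positive_selfadjoint power_defined_positive[OF assms]
      continuous_on_rspec_power assms real_power_nonneg)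

lemmas selfadjoint_powr = positive_selfadjoint[OF positive_powr]

lemma cstar_powr_zero: "cstar_positive a \<Longrightarrow> cstar_powr a 0 = 1"
  using rfc_const[OF positive_selfadjoint, of a 1]
  by (simp add: cstar_powr_eq_rfc)

lemma cstar_powr_one:
  assumes "cstar_positive a" shows "cstar_powr a 1 = a"
proof -
  note sa = positive_selfadjoint[OF assms]
  have "rfc (real_power 1) a = rfc (\<lambda>t. t) a"
    using assms continuous_on_rspec_power[of a 1] rspec_positive[of a]
    by (intro rfc_cong[OF sa]) (simp_all add: power_defined_nonneg)
  then show ?thesis by (simp add: cstar_powr_eq_rfc rfc_id[OF sa])
qed

lemma cstar_powr_add:
  assumes p: "power_defined a p" and q: "power_defined a q"
  shows "cstar_powr a (p + q) = cstar_powr a p * cstar_powr a q"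
proof -
  note sa = positive_selfadjoint[OF power_defined_positive[OF p]]
  note cont = continuous_on_rspec_power[OF p] continuous_on_rspec_power[OF q]
  have "rfc (\<lambda>t. real_power p t * real_power q t) a = rfc (real_power (p + q)) a"
  proof (rule rfc_cong[OF sa])
    fix t assume t: "t \<in> rspec a"
    show "real_power p t * real_power q t = real_power (p + q) t"
      using power_defined_rspec[OF p t] power_defined_rspec[OF q t]
      by (intro real_power_add[symmetric]) auto
  qed (intro continuous_on_mult cont)
  then show ?thesis by (simp add: cstar_powr_eq_rfc rfc_mult[OF sa] cont)
qed

lemma cstar_powr_powr:
  assumes p: "power_defined a p" and q: "power_defined a q"
  shows "cstar_powr (cstar_powr a p) q = cstar_powr a (p * q)"
proof -
  note sa = positive_selfadjoint[OF power_defined_positive[OF p]]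
  note cp = continuous_on_rspec_power[OF p]
  have z: "t = 0 \<Longrightarrow> 0 \<le> p \<and> 0 \<le> q" "0 \<le> t" if "t \<in> rspec a" for t
    using power_defined_rspec[OF p that] power_defined_rspec[OF q that] by auto
  have cq: "continuous_on (real_power p ` rspec a) (real_power q)"
  proof (rule continuous_on_real_power[OF continuous_on_id])
    fix s assume "s \<in> real_power p ` rspec a"
    then obtain t where t: "t \<in> rspec a" "s = real_power p t" by blast
    show "0 \<le> s" using t by (simp add: real_power_nonneg)
    show "0 \<le> q" if "s = 0"
      using z[OF t(1)] t(2) that real_power_pos[of t p] by (cases "t = 0") auto
  qed
  have "cstar_powr (cstar_powr a p) q = rfc (\<lambda>t. real_power q (real_power p t)) a"
    unfolding cstar_powr_eq_rfc by (rule rfc_compose[OF sa cp cq])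
  also have "\<dots> = rfc (real_power (p * q)) a"
  proof (rule rfc_cong[OF sa])
    fix t assume "t \<in> rspec a"
    then show "real_power q (real_power p t) = real_power (p * q) t"
      using z by (intro real_power_mult) auto
  qed (rule continuous_on_compose2[OF cq cp order_refl])
  finally show ?thesis by (simp add: cstar_powr_eq_rfc)
qed

lemma is_inverse_powr:
  assumes "power_defined a p" "power_defined a (- p)"
  shows "is_inverse (cstar_powr a p) (cstar_powr a (- p))"
  using cstar_powr_add[OF assms] cstar_powr_add[OF assms(2,1)] cstar_powr_zero[OF power_defined_positive[OF assms(1)]]
  by (simp add: is_inverse_def)

lemma cstar_powr_invertible:
  assumes "cstar_positive a" "0 \<notin> cstar_spectrum a"
  shows "0 \<notin> cstar_spectrum (cstar_powr a p)"
  using is_inverse_powr[of a p] assms by (auto simp: zero_notin_spectrum_iff power_defined_def)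

lemma cstar_powr_half_mult: "cstar_positive a \<Longrightarrow> cstar_powr a (1/2) * cstar_powr a (1/2) = a"
  using cstar_powr_add[of a "1/2" "1/2"] cstar_powr_one[of a] by (simp add: power_defined_nonneg)

lemma cstar_powr_half_unique:
  assumes "cstar_positive b" "b * b = a" shows "cstar_powr a (1/2) = b"
proof -
  have "cstar_powr b 2 = a"
    using cstar_powr_add[of b 1 1] assms by (simp add: power_defined_nonneg cstar_powr_one)
  then show ?thesis
    using cstar_powr_powr[of b 2 "1/2"] assms(1) by (simp add: power_defined_nonneg cstar_powr_one)
qed

text \<open>The regularisation by which statements about invertible elements are extended to all
  positive ones.\<close>

lemma add_scale_one:
  assumes "cstar_positive (a::'a::cstar_algebra)" "e > 0"
  shows "cstar_positive (a + e *\<^sub>R 1)" "0 \<notin> cstar_spectrum (a + e *\<^sub>R 1)"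
proof -
  show "cstar_positive (a + e *\<^sub>R 1)"
    using assms by (intro positive_add positive_scaleR) auto
  show "0 \<notin> cstar_spectrum (a + e *\<^sub>R 1)"
  proof
    assume "0 \<in> cstar_spectrum (a + e *\<^sub>R 1)"
    then have "complex_of_real (- e) \<in> cstar_spectrum a"
      using spectrum_shift[of "of_real e" "- of_real e" a] by (simp add: scaleR_scaleC add.commute)
    then show False using assms
      by (auto simp: cstar_positive_def subset_iff complex_eq_iff simp flip: of_real_minus)
  qed
qed

section \<open>Operator monotonicity of the square root\<close>

text \<open>The hypothesis says that \<open>a * b^(-1)\<close> has norm at most 1. Its nonzero
  spectrum is that of the self-adjoint \<open>b^(-1/2) * a * b^(-1/2)\<close>, whose norm is then at
  most 1 as well, so this element lies below the unit; conjugation by \<open>b^(1/2)\<close>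
  finishes.\<close>

lemma le_of_square_le_invertible:
  assumes a: "cstar_selfadjoint (a::'a::cstar_algebra)"
    and b: "cstar_positive b" "0 \<notin> cstar_spectrum b" and le: "a * a \<le>\<^sub>* b * b"
  shows "a \<le>\<^sub>* b"
proof -
  have def: "power_defined b p" for p using b by (simp add: power_defined_def)
  let ?P = "cstar_powr b"
  have add: "?P p * ?P q = ?P (p + q)" for p q using cstar_powr_add[OF def def] by simp
  have sa: "cstar_selfadjoint (?P p)" for p using selfadjoint_powr[OF def] .
  have star: "star (?P p) = ?P p" for p using sa by (simp add: cstar_selfadjoint_def)
  have 1: "?P 0 = 1" "?P 1 = b" using b by (simp_all add: cstar_powr_zero cstar_powr_one)
  let ?v = "?P (-1)" and ?h = "?P (- 1/2)" and ?k = "?P (1/2)"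
  have "?v * (a * a) * ?v \<le>\<^sub>* ?v * (?P 1 * ?P 1) * ?v"
    unfolding 1 by (rule le_conj_selfadjoint[OF sa le])
  also have "?v * (?P 1 * ?P 1) * ?v = 1" by (simp only: add) (simp add: 1)
  also have "?v * (a * a) * ?v = star (a * ?v) * (a * ?v)"
    using a by (simp add: star_mult star cstar_selfadjoint_def mult.assoc)
  finally have "norm (star (a * ?v) * (a * ?v)) \<le> 1"
    using norm_le_of_positive_le[OF positive_star_mult_self, of "a * ?v" 1] by simp
  then have "norm (a * ?v) \<le> 1" by (simp add: cstar_identity power_le_one_iff)
  let ?w = "?h * a * ?h"
  have w: "cstar_selfadjoint ?w" using selfadjoint_conj[OF a, of ?h] by (simp add: star)
  have "norm ?w \<le> 1"
  proof (rule norm_selfadjoint_le[OF w])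
    fix z assume z: "z \<in> cstar_spectrum ?w"
    show "cmod z \<le> 1"
    proof (cases "z = 0")
      case False
      have "z \<in> cstar_spectrum (?h * (a * ?h))" using z by (simp add: mult.assoc)
      from spectrum_mult_commute[OF this False]
      have "z \<in> cstar_spectrum (a * ?v)" by (simp add: mult.assoc add)
      then show ?thesis using norm_le_of_mem_spectrum \<open>norm (a * ?v) \<le> 1\<close> order_trans by blast
    qed simp
  qed simp
  then have "?w \<le>\<^sub>* 1" using le_norm[OF w, of 1] by simp
  from le_conj_selfadjoint[OF sa this, of "1/2"]
  have "?k * ?w * ?k \<le>\<^sub>* b" using cstar_powr_half_mult[OF b(1)] by simp
  moreover have "?k * ?w * ?k = (?k * ?h) * a * (?h * ?k)" by (simp only: mult.assoc)
  moreover have "?k * ?h = 1" "?h * ?k = 1" by (simp_all add: add 1)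
  ultimately show ?thesis by simp
qed

lemma le_of_square_le:
  assumes a: "cstar_selfadjoint (a::'a::cstar_algebra)" and b: "cstar_positive b"
    and le: "a * a \<le>\<^sub>* b * b"
  shows "a \<le>\<^sub>* b"
proof (rule le_epsilon)
  fix e :: real assume e: "e > 0"
  have "cstar_positive ((2 * e) *\<^sub>R b + (e * e) *\<^sub>R 1)"
    using b e by (intro positive_add positive_scaleR) auto
  moreover have "(b + e *\<^sub>R 1) * (b + e *\<^sub>R 1) - b * b = (2 * e) *\<^sub>R b + (e * e) *\<^sub>R 1"
    by (simp add: algebra_simps scaleR_2 flip: scaleR_scaleR)
  moreover have "cstar_selfadjoint (b + e *\<^sub>R 1)" "cstar_selfadjoint b"
    using b add_scale_one[OF b e] by (simp_all add: positive_selfadjoint)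
  ultimately have "b * b \<le>\<^sub>* (b + e *\<^sub>R 1) * (b + e *\<^sub>R 1)"
    by (simp add: cstar_le_def cstar_selfadjoint_def star_mult)
  from cstar_le_trans[OF le this] show "a \<le>\<^sub>* b + e *\<^sub>R 1"
    by (rule le_of_square_le_invertible[OF a add_scale_one[OF b e]])
qed

lemma cstar_powr_half_mono:
  assumes "cstar_positive a" "a \<le>\<^sub>* b" shows "cstar_powr a (1/2) \<le>\<^sub>* cstar_powr b (1/2)"
proof -
  have b: "cstar_positive b" using positive_of_le[OF assms] .
  show ?thesis
    by (rule le_of_square_le)
      (use assms b in \<open>simp_all add: cstar_powr_half_mult selfadjoint_powr positive_powr power_defined_nonneg\<close>)
qed

text \<open>Operator monotonicity replaces continuity of the square root: with \<open>d n\<close>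
  the root of \<open>norm (m - M n)\<close>, the limit \<open>m\<close> lies below the square of
  \<open>M n ^ (1/2) + d n\<close>, hence its root lies below
  \<open>M n ^ (1/2) + d n\<close>.\<close>

lemma cstar_powr_half_le_limit:
  assumes M: "\<And>n. cstar_positive (M n :: 'a::cstar_algebra)" "M \<longlonglongrightarrow> m" and C: "C \<longlonglongrightarrow> c"
    and le: "\<And>n. cstar_powr (M n) (1/2) \<le>\<^sub>* C n"
  shows "cstar_powr m (1/2) \<le>\<^sub>* c"
proof -
  have m: "cstar_positive m" using M by (intro tendsto_positive[OF M(2)]) auto
  define d where "d n = sqrt (norm (m - M n))" for n
  have "cstar_powr m (1/2) \<le>\<^sub>* cstar_powr (M n) (1/2) + d n *\<^sub>R 1" for n
  proof (rule le_of_square_le)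
    let ?r = "cstar_powr (M n) (1/2)"
    have r: "cstar_positive ?r" using M(1) by (simp add: positive_powr power_defined_nonneg)
    have d: "d n \<ge> 0" by (simp add: d_def)
    have "cstar_selfadjoint (m - M n)" using m M(1) by (simp add: positive_selfadjoint selfadjoint_simps)
    from le_norm[OF this order_refl] have "m - M n \<le>\<^sub>* (d n * d n) *\<^sub>R 1" by (simp add: d_def)
    moreover have "cstar_positive ((2 * d n) *\<^sub>R ?r)" using r d by (intro positive_scaleR) auto
    ultimately have "cstar_positive ((d n * d n) *\<^sub>R 1 - (m - M n) + (2 * d n) *\<^sub>R ?r)"
      by (auto simp: cstar_le_def intro!: positive_add)
    moreover have "(?r + d n *\<^sub>R 1) * (?r + d n *\<^sub>R 1) = M n + (2 * d n) *\<^sub>R ?r + (d n * d n) *\<^sub>R 1"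
      using cstar_powr_half_mult[OF M(1)] by (simp add: algebra_simps scaleR_2 flip: scaleR_scaleR)
    ultimately have "cstar_positive ((?r + d n *\<^sub>R 1) * (?r + d n *\<^sub>R 1) - m)"
      by (simp add: algebra_simps)
    moreover show pr: "cstar_positive (?r + d n *\<^sub>R 1)" using r d by (intro positive_add positive_scaleR) auto
    ultimately show "cstar_powr m (1/2) * cstar_powr m (1/2) \<le>\<^sub>* (?r + d n *\<^sub>R 1) * (?r + d n *\<^sub>R 1)"
      unfolding cstar_powr_half_mult[OF m] cstar_le_def
      using m positive_square[OF positive_selfadjoint[OF pr]] positive_selfadjoint by blast
    show "cstar_selfadjoint (cstar_powr m (1/2))" using m by (simp add: selfadjoint_powr power_defined_nonneg)
  qed
  moreover have "cstar_powr (M n) (1/2) + d n *\<^sub>R 1 \<le>\<^sub>* C n + d n *\<^sub>R 1" for n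
    using le by (intro le_add_mono cstar_le_refl) (auto simp: selfadjoint_simps)
  ultimately have ev: "cstar_powr m (1/2) \<le>\<^sub>* C n + d n *\<^sub>R 1" for n using cstar_le_trans by blast
  have "(\<lambda>n. norm (m - M n)) \<longlonglongrightarrow> norm (m - m)" by (intro tendsto_intros M)
  then have "d \<longlonglongrightarrow> sqrt 0" unfolding d_def by (intro tendsto_intros) simp
  then have "(\<lambda>n. C n + d n *\<^sub>R 1) \<longlonglongrightarrow> c + 0 *\<^sub>R 1" by (intro tendsto_intros C) simp
  then show ?thesis using ev by (intro tendsto_cstar_le[OF tendsto_const]) auto
qed

section \<open>Continuity of powers\<close>

lemma cstar_powr_add_scale:
  assumes X: "cstar_positive (X::'a::cstar_algebra)" and e: "e \<ge> 0" and p: "p \<ge> 0"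
  shows "cstar_powr (X + e *\<^sub>R 1) p = rfc (\<lambda>t. real_power p (t + e)) X"
proof -
  note sa = positive_selfadjoint[OF X]
  have "rfc (\<lambda>t. t + e) X = X + e *\<^sub>R 1"
    using rfc_add[OF sa, of "\<lambda>t. t" "\<lambda>t. e"] by (simp add: rfc_id[OF sa] rfc_const[OF sa])
  moreover have "rfc (real_power p) (rfc (\<lambda>t. t + e) X) = rfc (\<lambda>t. real_power p (t + e)) X"
  proof (rule rfc_compose[OF sa])
    show "continuous_on ((\<lambda>t. t + e) ` rspec X) (real_power p)"
    proof (rule continuous_on_real_power[OF continuous_on_id])
      fix x assume "x \<in> (\<lambda>t. t + e) ` rspec X"
      then show "0 \<le> x" using rspec_positive[OF X] e by auto
    qed (rule p)
  qed (intro continuous_intros)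
  ultimately show ?thesis by (simp add: cstar_powr_eq_rfc)
qed

lemma continuous_on_shift_power:
  assumes "cstar_positive X" "e \<ge> 0" "p \<ge> 0"
  shows "continuous_on (rspec X) (\<lambda>t. real_power p (t + e))"
proof (rule continuous_on_real_power)
  show "continuous_on (rspec X) (\<lambda>t. t + e)" by (intro continuous_intros)
  show "0 \<le> x + e" if "x \<in> rspec X" for x using rspec_positive[OF assms(1) that] assms(2) by simp
qed (rule assms)

text \<open>Both sides are functions of \<open>X\<close>, so for every exponent
  \<open>p \<ge> 0\<close> this is scalar monotonicity under the functional calculus.\<close>

lemma cstar_powr_le_powr_add_scale:
  assumes X: "cstar_positive (X::'a::cstar_algebra)" and "e \<ge> 0" "p \<ge> 0"
  shows "cstar_powr X p \<le>\<^sub>* cstar_powr (X + e *\<^sub>R 1) p"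
proof -
  have "rfc (real_power p) X \<le>\<^sub>* rfc (\<lambda>t. real_power p (t + e)) X"
  proof (rule rfc_mono[OF positive_selfadjoint[OF X]])
    show "real_power p t \<le> real_power p (t + e)" if "t \<in> rspec X" for t
      using rspec_positive[OF X that] assms by (intro real_power_mono) auto
    show "continuous_on (rspec X) (real_power p)"
      using continuous_on_rspec_power[OF power_defined_nonneg[OF X assms(3)]] .
  qed (rule continuous_on_shift_power[OF assms])
  then show ?thesis using assms by (simp add: cstar_powr_eq_rfc cstar_powr_add_scale[unfolded cstar_powr_eq_rfc])
qed

lemma rspec_subset:
  assumes "cstar_positive a" obtains M where "M > 0" "rspec a \<subseteq> {0..M}"
proof -
  have "bounded (rspec a)" using compact_rspec by (rule compact_imp_bounded)
  then obtain M where M: "M > 0" "\<And>t. t \<in> rspec a \<Longrightarrow> \<bar>t\<bar> \<le> M" by (auto simp: bounded_pos)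
  then have "rspec a \<subseteq> {0..M}" using rspec_positive[OF assms] by force
  with M(1) show ?thesis by (rule that)
qed

lemma cstar_powr_add_scale_tendsto:
  assumes X: "cstar_positive (X::'a::cstar_algebra)" and p: "p \<ge> 0"
  shows "((\<lambda>e. cstar_powr (X + e *\<^sub>R 1) p) \<longlongrightarrow> cstar_powr X p) (at_right 0)"
proof -
  obtain M where M: "M > 0" "rspec X \<subseteq> {0..M}" using rspec_subset[OF X] .
  \<comment> \<open>The interval is longer by 1 to hold \<open>t + e\<close> for the shifts
    \<open>e < 1\<close> considered below.\<close>
  have "continuous_on {0..M + 1} (real_power p)"
    by (rule continuous_on_real_power[OF continuous_on_id]) (use p in auto)
  then have uc: "uniformly_continuous_on {0..M + 1} (real_power p)"
    by (intro compact_uniformly_continuous) auto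
  have lim: "uniform_limit (rspec X) (\<lambda>e t. real_power p (t + e)) (real_power p) (at_right 0)"
  proof (rule uniform_limitI)
    fix r :: real assume "r > 0"
    then obtain d where d: "d > 0" "\<And>x y. x \<in> {0..M + 1} \<Longrightarrow> y \<in> {0..M + 1} \<Longrightarrow> dist y x < d \<Longrightarrow>
        dist (real_power p y) (real_power p x) < r"
      using uc unfolding uniformly_continuous_on_def by metis
    have "eventually (\<lambda>e. e \<in> {0<..<min d 1}) (at_right 0)"
      using d(1) by (intro eventually_at_right_real) auto
    then show "eventually (\<lambda>e. \<forall>t\<in>rspec X. dist (real_power p (t + e)) (real_power p t) < r) (at_right 0)"
    proof eventually_elim
      case (elim e)
      show ?case
      proof
        fix t assume "t \<in> rspec X"
        then have "t \<in> {0..M}" using M by blast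
        then show "dist (real_power p (t + e)) (real_power p t) < r"
          using elim by (intro d(2)) (auto simp: dist_norm)
      qed
    qed
  qed
  have pos: "eventually (\<lambda>e::real. e > 0) (at_right 0)" by (simp add: eventually_at_right_less)
  have "((\<lambda>e. rfc (\<lambda>t. real_power p (t + e)) X) \<longlongrightarrow> rfc (real_power p) X) (at_right 0)"
  proof (rule rfc_tendsto[OF positive_selfadjoint[OF X] _ _ lim])
    show "continuous_on (rspec X) (real_power p)"
      using continuous_on_rspec_power[OF power_defined_nonneg[OF X p]] .
    show "eventually (\<lambda>e. continuous_on (rspec X) (\<lambda>t. real_power p (t + e))) (at_right 0)"
      using pos by eventually_elim (simp add: continuous_on_shift_power X p)
  qed
  then show ?thesis
    unfolding cstar_powr_eq_rfc[of X]
    by (rule Lim_transform_eventually)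
      (use pos in \<open>eventually_elim, simp add: cstar_powr_add_scale X p\<close>)
qed

lemma cstar_powr_tendsto_exponent:
  assumes a: "cstar_positive (a::'a::cstar_algebra)" and s: "s > 0" "\<And>n. \<sigma> n > 0" "\<sigma> \<longlonglongrightarrow> s"
  shows "(\<lambda>n. cstar_powr a (\<sigma> n)) \<longlonglongrightarrow> cstar_powr a s"
proof -
  obtain M where M: "M > 0" "rspec a \<subseteq> {0..M}" using rspec_subset[OF a] .
  \<comment> \<open>The exponents stay in a compact interval away from 0, because
    \<open>t powr r\<close> is not continuous at \<open>t = 0\<close>, \<open>r = 0\<close>.\<close>
  let ?K = "{0..M} \<times> {s/2..s + 1}"
  have "continuous_on ?K (\<lambda>z. fst z powr snd z)"
    by (intro continuous_on_powr' continuous_intros) (use s(1) in auto)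
  then have uc: "uniformly_continuous_on ?K (\<lambda>z. fst z powr snd z)"
    by (intro compact_uniformly_continuous compact_Times) auto
  have lim: "uniform_limit (rspec a) (\<lambda>n. real_power (\<sigma> n)) (real_power s) sequentially"
  proof (rule uniform_limitI)
    fix r :: real assume "r > 0"
    then obtain d where d: "d > 0" "\<And>x y. x \<in> ?K \<Longrightarrow> y \<in> ?K \<Longrightarrow> dist y x < d \<Longrightarrow>
        dist (fst y powr snd y) (fst x powr snd x) < r"
      using uc unfolding uniformly_continuous_on_def by metis
    have "eventually (\<lambda>n. dist (\<sigma> n) s < min d (min (s/2) 1)) sequentially"
      using d(1) s by (intro tendstoD) auto
    then show "eventually (\<lambda>n. \<forall>t\<in>rspec a. dist (real_power (\<sigma> n) t) (real_power s t) < r) sequentially"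
    proof eventually_elim
      case (elim n)
      show ?case
      proof
        fix t assume t: "t \<in> rspec a"
        have "\<bar>\<sigma> n - s\<bar> < s/2" "\<bar>\<sigma> n - s\<bar> < 1"
          using elim unfolding dist_real_def by linarith+
        then have "s - s/2 < \<sigma> n" "\<sigma> n < s + 1" unfolding abs_diff_less_iff by linarith+
        then have "\<sigma> n \<in> {s/2..s + 1}" "s \<in> {s/2..s + 1}" using s(1) by auto
        moreover have "dist (t, \<sigma> n) (t, s) < d" using elim by (simp add: dist_Pair_Pair)
        ultimately have "dist (t powr \<sigma> n) (t powr s) < r"
          using d(2)[of "(t, s)" "(t, \<sigma> n)"] t M by auto
        then show "dist (real_power (\<sigma> n) t) (real_power s t) < r"
          using s by (simp add: real_power_def less_imp_neq[symmetric])
      qed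
    qed
  qed
  show ?thesis
    unfolding cstar_powr_eq_rfc
    using s a by (intro rfc_tendsto[OF positive_selfadjoint[OF a] _ _ lim] always_eventually allI
        continuous_on_rspec_power power_defined_nonneg) (auto simp: less_imp_le)
qed

section \<open>Positive block matrices\<close>

text \<open>Positivity of the matrix with rows \<open>(P, Y)\<close> and \<open>(Y, Q)\<close>.\<close>

definition block_positive :: "'a::cstar_algebra \<Rightarrow> 'a \<Rightarrow> 'a \<Rightarrow> bool"
  where "block_positive P Y Q \<longleftrightarrow>
    (\<forall>x y. cstar_positive (star x * P * x + star x * Y * y + star y * Y * x + star y * Q * y))"

lemma block_positive_mono:
  assumes "block_positive P Y Q" "P \<le>\<^sub>* P'" "Q \<le>\<^sub>* Q'"
  shows "block_positive P' Y Q'"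
  unfolding block_positive_def
proof (intro allI)
  fix x y
  have "cstar_positive (star x * P * x + star x * Y * y + star y * Y * x + star y * Q * y
      + star x * (P' - P) * x + star y * (Q' - Q) * y)"
    using assms
    by (intro positive_add[OF positive_add[OF _ positive_conj] positive_conj])
      (simp_all add: block_positive_def cstar_le_def)
  then show "cstar_positive (star x * P' * x + star x * Y * y + star y * Y * x + star y * Q' * y)"
    by (simp add: algebra_simps)
qed

text \<open>The Schur complement gives \<open>Y * X^(-v) * Y \<le> X^u\<close>. Conjugation by
  \<open>X^(-v/2)\<close> turns the left side into the square of
  \<open>X^(-v/2) * Y * X^(-v/2)\<close> and the right side into that of \<open>X^((u-v)/2)\<close>;
  after taking roots the conjugation is undone. The bound is the geometric mean of
  \<open>X^u\<close> and \<open>X^v\<close>.\<close>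

lemma block_positive_powr_invertible:
  assumes X: "cstar_positive X" "0 \<notin> cstar_spectrum X" and Y: "cstar_selfadjoint Y"
    and b: "block_positive (cstar_powr X u) Y (cstar_powr X v)"
  shows "Y \<le>\<^sub>* cstar_powr X ((u + v) / 2)"
proof -
  have def: "power_defined X p" for p using X by (simp add: power_defined_def)
  let ?P = "cstar_powr X"
  have add: "?P p * ?P q = ?P (p + q)" for p q using cstar_powr_add[OF def def] by simp
  have add': "?P p * (?P q * z) = ?P (p + q) * z" for p q z by (simp add: add flip: mult.assoc)
  have sa: "cstar_selfadjoint (?P p)" for p using selfadjoint_powr[OF def] .
  have star: "star (?P p) = ?P p" for p using sa by (simp add: cstar_selfadjoint_def)
  have 1: "?P 0 = 1" using X by (simp add: cstar_powr_zero)
  \<comment> \<open>Completes the square: for \<open>x = 1\<close> the quadratic form is minimal in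
    \<open>y\<close> at this point.\<close>
  let ?y = "- ?P (- v) * Y"
  have "cstar_positive (star 1 * ?P u * 1 + star 1 * Y * ?y + star ?y * Y * 1 + star ?y * ?P v * ?y)"
    using b unfolding block_positive_def by blast
  moreover have "star ?y = - Y * ?P (- v)"
    using Y by (simp add: star_simps star cstar_selfadjoint_def)
  moreover have "?P v * (?P (- v) * Y) = Y" by (simp add: add' 1)
  ultimately have "cstar_positive (?P u - Y * ?P (- v) * Y)"
    by (simp add: mult.assoc)
  then have le: "Y * ?P (- v) * Y \<le>\<^sub>* ?P u"
    using selfadjoint_conj[OF sa, of Y] Y sa by (simp add: cstar_le_def cstar_selfadjoint_def)
  let ?h = "?P (- v / 2)" and ?k = "?P (v / 2)"
  let ?c = "?h * Y * ?h"
  have "?h * (Y * ?P (- v) * Y) * ?h = ?c * ?c" by (simp add: mult.assoc add')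
  moreover have "?h * ?P u * ?h = ?P ((u - v) / 2) * ?P ((u - v) / 2)"
    by (simp add: add)
  ultimately have sq: "?c * ?c \<le>\<^sub>* ?P ((u - v) / 2) * ?P ((u - v) / 2)"
    using le_conj_selfadjoint[OF sa le, of "- v / 2"] by simp
  have "cstar_selfadjoint ?c" using selfadjoint_conj[OF Y, of ?h] by (simp add: star)
  then have "?c \<le>\<^sub>* ?P ((u - v) / 2)" by (rule le_of_square_le[OF _ positive_powr[OF def] sq])
  from le_conj_selfadjoint[OF sa this, of "v / 2"]
  have "?k * ?c * ?k \<le>\<^sub>* ?k * ?P ((u - v) / 2) * ?k" .
  moreover have "?k * ?c * ?k = Y" by (simp add: mult.assoc add' add 1)
  moreover have "?k * ?P ((u - v) / 2) * ?k = ?P ((u + v) / 2)"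
    by (simp add: add field_simps)
  ultimately show ?thesis by simp
qed

text \<open>Replacing \<open>X\<close> by \<open>X + e\<close> increases both diagonal entries, so
  the block stays positive and the invertible case applies before \<open>e\<close> tends to
  0.\<close>

lemma block_positive_powr:
  assumes X: "cstar_positive X" and Y: "cstar_selfadjoint Y" and uv: "u \<ge> 0" "v \<ge> 0"
    and b: "block_positive (cstar_powr X u) Y (cstar_powr X v)"
  shows "Y \<le>\<^sub>* cstar_powr X ((u + v) / 2)"
proof (rule tendsto_cstar_le)
  show "((\<lambda>e. cstar_powr (X + e *\<^sub>R 1) ((u + v) / 2)) \<longlongrightarrow> cstar_powr X ((u + v) / 2)) (at_right 0)"
    using uv by (intro cstar_powr_add_scale_tendsto X) simp
  have "eventually (\<lambda>e::real. e > 0) (at_right 0)" by (simp add: eventually_at_right_less)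
  then show "eventually (\<lambda>e. Y \<le>\<^sub>* cstar_powr (X + e *\<^sub>R 1) ((u + v) / 2)) (at_right 0)"
  proof eventually_elim
    case (elim e)
    show ?case
    proof (rule block_positive_powr_invertible[OF add_scale_one[OF X elim] Y])
      show "block_positive (cstar_powr (X + e *\<^sub>R 1) u) Y (cstar_powr (X + e *\<^sub>R 1) v)"
        using elim uv by (intro block_positive_mono[OF b] cstar_powr_le_powr_add_scale X) auto
    qed
  qed
qed (simp_all add: trivial_limit_at_right_real)

section \<open>Positive sub-unital maps\<close>

locale positive_subunital =
  fixes \<Phi> :: "'a::cstar_algebra \<Rightarrow> 'm::cstar_algebra"
  assumes pos_linear: "cstar_positive_linear_map \<Phi>" and subunital: "\<Phi> 1 \<le>\<^sub>* 1"
begin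

lemma map_add: "\<Phi> (x + y) = \<Phi> x + \<Phi> y"
  and map_scaleC: "\<Phi> (c *\<^sub>C x) = c *\<^sub>C \<Phi> x"
  and map_positive: "cstar_positive x \<Longrightarrow> cstar_positive (\<Phi> x)"
  using pos_linear unfolding cstar_positive_linear_map_def by blast+

lemma map_scaleR: "\<Phi> (r *\<^sub>R x) = r *\<^sub>R \<Phi> x"
  by (simp add: scaleR_scaleC map_scaleC)

lemma map_zero: "\<Phi> 0 = 0"
  using map_add[of 0 0] by simp

lemma map_diff: "\<Phi> (x - y) = \<Phi> x - \<Phi> y"
  using map_add[of "x - y" y] by simp

lemma map_sum: "\<Phi> (sum f I) = (\<Sum>i\<in>I. \<Phi> (f i))"
  by (induction I rule: infinite_finite_induct) (simp_all add: map_zero map_add)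

lemma map_selfadjoint:
  assumes "cstar_selfadjoint a" shows "cstar_selfadjoint (\<Phi> a)"
proof -
  have "cstar_positive (norm a *\<^sub>R 1 - a)" by (rule positive_norm_minus[OF assms order_refl])
  moreover have "cstar_positive (norm a *\<^sub>R (1::'a))" by (intro positive_scaleR) auto
  ultimately have "cstar_selfadjoint (\<Phi> (norm a *\<^sub>R 1) - \<Phi> (norm a *\<^sub>R 1 - a))"
    by (intro selfadjoint_simps positive_selfadjoint map_positive)
  then show ?thesis by (simp add: map_diff)
qed

lemma map_le: "a \<le>\<^sub>* b \<Longrightarrow> \<Phi> a \<le>\<^sub>* \<Phi> b"
  using map_positive[of "b - a"] by (simp add: cstar_le_def map_diff map_selfadjoint)

text \<open>Positivity and \<open>\<Phi> 1 \<le> 1\<close> squeeze \<open>\<Phi> a\<close> between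
  multiples of the unit. This supplies the continuity by which limits are taken inside
  \<open>\<Phi>\<close>.\<close>

lemma norm_map_le:
  assumes "cstar_selfadjoint a" shows "norm (\<Phi> a) \<le> norm a"
proof (rule norm_le_of_le)
  have "cstar_positive (norm a *\<^sub>R (1 - \<Phi> 1))"
    using subunital by (intro positive_scaleR) (auto simp: cstar_le_def)
  then have s: "norm a *\<^sub>R \<Phi> 1 \<le>\<^sub>* norm a *\<^sub>R 1"
    using subunital by (simp add: cstar_le_def selfadjoint_simps scaleR_diff_right)
  have up: "\<Phi> b \<le>\<^sub>* norm b *\<^sub>R \<Phi> 1" if "cstar_selfadjoint b" for b
    using map_le[OF le_norm[OF that order_refl]] by (simp add: map_scaleR)
  show "\<Phi> a \<le>\<^sub>* norm a *\<^sub>R 1" using cstar_le_trans[OF up[OF assms] s] .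
  have "\<Phi> (- a) \<le>\<^sub>* norm a *\<^sub>R 1" using cstar_le_trans[OF up[of "- a"]] s assms by (simp add: selfadjoint_simps)
  then show "- norm a *\<^sub>R 1 \<le>\<^sub>* \<Phi> a"
    using le_minus[of "\<Phi> (- a)" "norm a *\<^sub>R 1"] map_diff[of 0 a] by (simp add: map_zero)
qed simp

lemma map_tendsto:
  assumes "f \<longlonglongrightarrow> a" "\<And>n. cstar_selfadjoint (f n)" shows "(\<lambda>n. \<Phi> (f n)) \<longlonglongrightarrow> \<Phi> a"
proof -
  have "cstar_selfadjoint a" using assms by (intro tendsto_selfadjoint[OF assms(1)]) auto
  then have le: "norm (\<Phi> (f n) - \<Phi> a) \<le> norm (f n - a)" for n
    using norm_map_le[of "f n - a"] assms(2) by (simp add: map_diff selfadjoint_simps)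
  have "(\<lambda>n. norm (f n - a)) \<longlonglongrightarrow> 0" by (intro tendsto_norm_zero LIM_zero assms)
  then have "(\<lambda>n. \<Phi> (f n) - \<Phi> a) \<longlonglongrightarrow> 0"
    by (rule Lim_null_comparison[OF always_eventually[OF allI[OF le]]])
  then show ?thesis by (simp add: LIM_zero_iff)
qed

text \<open>Bernstein polynomials are used because their coefficients are samples of
  \<open>h\<close>, so those of \<open>f * g\<close> are products of samples of \<open>f\<close> and
  \<open>g\<close>, and because their basis functions are nonnegative. The factor \<open>M\<close>
  rescales from \<open>[0, 1]\<close> to \<open>[0, M]\<close>.\<close>

lemma map_bernstein_tendsto:
  assumes a: "cstar_selfadjoint a" and M: "M > 0" "rspec a \<subseteq> {0..M}" and h: "continuous_on {0..M} h"
  shows "(\<lambda>n. \<Sum>k\<le>n. h (M * (k / n)) *\<^sub>R \<Phi> (rfc (\<lambda>t. Bernstein n k (t / M)) a)) \<longlonglongrightarrow> \<Phi> (rfc h a)"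
proof -
  have ch: "continuous_on (rspec a) h" using h M(2) continuous_on_subset by blast
  have cB: "continuous_on S (\<lambda>t. Bernstein n k (t / M))" for S n k
    unfolding Bernstein_def using M(1) by (intro continuous_intros) auto
  define q where "q n t = (\<Sum>k\<le>n. h (M * (k / n)) * Bernstein n k (t / M))" for n :: nat and t
  have cq: "continuous_on (rspec a) (q n)" for n unfolding q_def by (intro continuous_intros cB)
  have q: "rfc (q n) a = (\<Sum>k\<le>n. h (M * (k / n)) *\<^sub>R rfc (\<lambda>t. Bernstein n k (t / M)) a)" for n
    unfolding q_def by (subst rfc_sum[OF a]) (auto intro!: continuous_intros cB sum.cong rfc_scale[OF a])
  have "uniform_limit (rspec a) q h sequentially"
  proof (rule uniform_limitI)
    fix e :: real assume e: "e > 0"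
    have "continuous_on {0..1} (\<lambda>x. h (M * x))"
      by (rule continuous_on_compose2[OF h]) (use M(1) in \<open>auto intro!: continuous_intros mult_left_le\<close>)
    from Bernstein_Weierstrass[OF this e] obtain N where
      N: "\<And>n x. N \<le> n \<Longrightarrow> x \<in> {0..1} \<Longrightarrow> \<bar>h (M * x) - (\<Sum>k\<le>n. h (M * (k / n)) * Bernstein n k x)\<bar> < e"
      by blast
    have "dist (q n t) (h t) < e" if "n \<ge> N" "t \<in> rspec a" for n t
    proof -
      have "t \<in> {0..M}" using that M by blast
      then have "t / M \<in> {0..1}" using M(1) by (simp add: divide_le_eq_1)
      from N[OF that(1) this] show ?thesis using M(1) by (simp add: dist_real_def q_def abs_minus_commute)
    qed
    then show "eventually (\<lambda>n. \<forall>t\<in>rspec a. dist (q n t) (h t) < e) sequentially"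
      unfolding eventually_sequentially by blast
  qed
  then have "(\<lambda>n. rfc (q n) a) \<longlonglongrightarrow> rfc h a"
    using cq by (intro rfc_tendsto[OF a ch]) auto
  then have "(\<lambda>n. \<Phi> (rfc (q n) a)) \<longlonglongrightarrow> \<Phi> (rfc h a)"
    by (rule map_tendsto) (rule selfadjoint_rfc[OF a cq])
  then show ?thesis by (simp add: q map_sum map_scaleR)
qed

text \<open>
  On the commutative algebra generated by \<open>a\<close> the map is 2-positive: approximating by Bernstein
  polynomials, the quadratic form becomes a sum of conjugates of the positive elements
  \<open>\<Phi>(B\<^sub>n\<^sub>k(a))\<close>.
\<close>

lemma map_block_positive:
  assumes a: "cstar_positive a" and M: "M > 0" "rspec a \<subseteq> {0..M}"
    and f: "continuous_on {0..M} f" and g: "continuous_on {0..M} g"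
  shows "block_positive (\<Phi> (rfc (\<lambda>t. f t * f t) a)) (\<Phi> (rfc (\<lambda>t. f t * g t) a))
    (\<Phi> (rfc (\<lambda>t. g t * g t) a))"
  unfolding block_positive_def
proof (intro allI)
  fix x y :: 'm
  note sa = positive_selfadjoint[OF a]
  define B where "B n k = \<Phi> (rfc (\<lambda>t. Bernstein n k (t / M)) a)" for n k
  define S where "S h n = (\<Sum>k\<le>n. h (M * (k / n)) *\<^sub>R B n k)" for h :: "real \<Rightarrow> real" and n :: nat
  have S: "S h \<longlonglongrightarrow> \<Phi> (rfc h a)" if "continuous_on {0..M} h" for h
    unfolding S_def B_def by (rule map_bernstein_tendsto[OF sa M that])
  have B: "cstar_positive (B n k)" for n k
    unfolding B_def
  proof (intro map_positive positive_rfc[OF sa])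
    show "continuous_on (rspec a) (\<lambda>t. Bernstein n k (t / M))"
      unfolding Bernstein_def using M(1) by (intro continuous_intros) auto
    show "0 \<le> Bernstein n k (t / M)" if "t \<in> rspec a" for t
      using that M by (intro Bernstein_nonneg) (auto simp: divide_le_eq_1)
  qed
  let ?F = "\<lambda>P Y Q. star x * P * x + star x * Y * y + star y * Y * x + star y * Q * y"
  let ?ff = "\<lambda>t. f t * f t" and ?fg = "\<lambda>t. f t * g t" and ?gg = "\<lambda>t. g t * g t"
  have pos: "cstar_positive (?F (S ?ff n) (S ?fg n) (S ?gg n))" for n
  proof -
    \<comment> \<open>The samples at the node \<open>k\<close> form a rank-one matrix, so its
      quadratic form is the conjugate of \<open>B n k\<close> by a single element.\<close>
    let ?z = "\<lambda>k. f (M * (k / n)) *\<^sub>R x + g (M * (k / n)) *\<^sub>R y"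
    have "?F (S ?ff n) (S ?fg n) (S ?gg n) = (\<Sum>k\<le>n. star (?z k) * B n k * ?z k)"
      by (simp add: S_def star_simps algebra_simps sum_distrib_left sum_distrib_right
          flip: sum.distrib)
    then show ?thesis using B by (simp add: positive_sum positive_conj)
  qed
  have "(\<lambda>n. ?F (S ?ff n) (S ?fg n) (S ?gg n))
      \<longlonglongrightarrow> ?F (\<Phi> (rfc ?ff a)) (\<Phi> (rfc ?fg a)) (\<Phi> (rfc ?gg a))"
    by (intro tendsto_intros S continuous_intros f g)
  then show "cstar_positive (?F (\<Phi> (rfc ?ff a)) (\<Phi> (rfc ?fg a)) (\<Phi> (rfc ?gg a)))"
    by (rule tendsto_positive) (simp_all add: pos)
qed

text \<open>Take \<open>f\<close> and \<open>g\<close> to be the powers \<open>u / 2\<close> and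
  \<open>v / 2\<close>; the product \<open>f * g\<close> then has the exponent
  \<open>(u + v) / 2\<close>.\<close>

lemma map_powr_block_positive:
  assumes a: "cstar_positive a" and uv: "u \<ge> 0" "v \<ge> 0"
  shows "block_positive (\<Phi> (cstar_powr a u)) (\<Phi> (cstar_powr a ((u + v) / 2))) (\<Phi> (cstar_powr a v))"
proof -
  obtain M where M: "M > 0" "rspec a \<subseteq> {0..M}" using rspec_subset[OF a] .
  have c: "continuous_on {0..M} (real_power p)" if "p \<ge> 0" for p
    by (rule continuous_on_real_power[OF continuous_on_id]) (use that in auto)
  have eq: "rfc (\<lambda>t. real_power p t * real_power q t) a = cstar_powr a (p + q)" if "p \<ge> 0" "q \<ge> 0" for p q
  proof -
    have "continuous_on (rspec a) (real_power r)" if "r \<ge> 0" for r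
      using c[OF that] M(2) continuous_on_subset by blast
    then show ?thesis
      using that cstar_powr_add[of a p q] a
      by (simp add: rfc_mult[OF positive_selfadjoint[OF a]] cstar_powr_eq_rfc power_defined_nonneg)
  qed
  show ?thesis
    using map_block_positive[OF a M c c, of "u / 2" "v / 2"] uv
    by (simp add: eq add_divide_distrib)
qed

end

text \<open>Midpoints generate the dyadic fractions, and limits give the rest. The limit hypothesis
  is restricted to positive exponents because powers are not continuous in the exponent at
  0.\<close>

lemma midpoint_closed_unit_interval:
  fixes P :: "real \<Rightarrow> bool"
  assumes P01: "P 0" "P 1"
    and mid: "\<And>u v. 0 \<le> u \<Longrightarrow> 0 \<le> v \<Longrightarrow> P u \<Longrightarrow> P v \<Longrightarrow> P ((u + v) / 2)"
    and lim: "\<And>\<sigma> s. s > 0 \<Longrightarrow> (\<And>n. \<sigma> n > 0) \<Longrightarrow> \<sigma> \<longlonglongrightarrow> s \<Longrightarrow> (\<And>n. P (\<sigma> n)) \<Longrightarrow> P s"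
    and s: "0 \<le> s" "s \<le> 1"
  shows "P s"
proof (cases "s = 0")
  case False
  have dyadic: "P (real k / 2 ^ n)" if "k \<le> 2 ^ n" for k n
    using that
  proof (induction n arbitrary: k)
    case 0
    then have "k = 0 \<or> k = 1" by auto
    then show ?case using P01 by auto
  next
    case (Suc n)
    \<comment> \<open>For \<open>k \<le> 2 ^ (n + 1)\<close> both integer halves of \<open>k\<close>
      are at most \<open>2 ^ n\<close>, and \<open>k / 2 ^ (n + 1)\<close> is the midpoint of the
      corresponding fractions.\<close>
    have "P ((real (k div 2) / 2 ^ n + real (k - k div 2) / 2 ^ n) / 2)"
      using Suc.prems by (intro mid Suc.IH) auto
    moreover have "real (k div 2) + real (k - k div 2) = real k" by (simp flip: of_nat_add)
    ultimately show ?case by (simp add: add_divide_distrib[symmetric] mult.commute)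
  qed
  \<comment> \<open>Rounding up keeps \<open>\<sigma> n\<close> at least \<open>s\<close>, hence
    positive; \<open>s \<le> 1\<close> keeps it at most 1.\<close>
  define \<sigma> where "\<sigma> n = real (nat \<lceil>2 ^ n * s\<rceil>) / 2 ^ n" for n :: nat
  have pos: "2 ^ n * s > 0" for n :: nat using s False by simp
  have b: "2 ^ n * s \<le> real (nat \<lceil>2 ^ n * s\<rceil>)" "real (nat \<lceil>2 ^ n * s\<rceil>) \<le> 2 ^ n * s + 1" for n :: nat
    using pos[of n] by linarith+
  have lo: "s \<le> \<sigma> n" for n using b(1)[of n] by (simp add: \<sigma>_def field_simps)
  have up: "\<sigma> n \<le> s + (1/2) ^ n" for n
    using b(2)[of n] by (simp add: \<sigma>_def field_simps power_one_over)
  have "P (\<sigma> n)" for n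
    unfolding \<sigma>_def
  proof (rule dyadic)
    have "2 ^ n * s \<le> 2 ^ n" using s by simp
    then have "\<lceil>2 ^ n * s\<rceil> \<le> 2 ^ n" by (simp add: ceiling_le_iff)
    then show "nat \<lceil>2 ^ n * s\<rceil> \<le> 2 ^ n" by (simp add: nat_le_iff)
  qed
  moreover have "\<sigma> \<longlonglongrightarrow> s"
  proof (rule tendsto_sandwich[where f = "\<lambda>_. s" and h = "\<lambda>n. s + (1/2) ^ n"])
    have "(\<lambda>n. s + (1/2) ^ n) \<longlonglongrightarrow> s + 0" by (intro tendsto_intros LIMSEQ_power_zero) simp
    then show "(\<lambda>n. s + (1/2) ^ n) \<longlonglongrightarrow> s" by simp
  qed (use lo up in auto)
  moreover have "\<sigma> n > 0" for n using lo[of n] s False by linarith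
  ultimately show ?thesis using lim[of s \<sigma>] s False by simp
qed (use P01 in simp)

section \<open>Jensen's operator inequalities and the Loewner-Heinz inequality\<close>

context positive_subunital
begin

text \<open>
  The exponents for which the claim holds contain 0 and 1 and are closed under limits; they are
  closed under midpoints by applying \<open>block_positive_powr\<close> to the Cauchy--Schwarz block.
\<close>

lemma map_powr_le:
  assumes a: "cstar_positive a" and X: "cstar_positive X" and le: "\<Phi> a \<le>\<^sub>* X"
    and s: "0 \<le> s" "s \<le> 1"
  shows "\<Phi> (cstar_powr a s) \<le>\<^sub>* cstar_powr X s"
proof (rule midpoint_closed_unit_interval[where P = "\<lambda>s. \<Phi> (cstar_powr a s) \<le>\<^sub>* cstar_powr X s"])
  \<comment> \<open>At exponent 0 the claim is exactly sub-unitality.\<close>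
  show "\<Phi> (cstar_powr a 0) \<le>\<^sub>* cstar_powr X 0" using a X subunital by (simp add: cstar_powr_zero)
  show "\<Phi> (cstar_powr a 1) \<le>\<^sub>* cstar_powr X 1" using a X le by (simp add: cstar_powr_one)
next
  fix u v :: real
  assume uv: "0 \<le> u" "0 \<le> v" and le: "\<Phi> (cstar_powr a u) \<le>\<^sub>* cstar_powr X u"
    "\<Phi> (cstar_powr a v) \<le>\<^sub>* cstar_powr X v"
  have "cstar_selfadjoint (\<Phi> (cstar_powr a ((u + v) / 2)))"
    using uv by (intro map_selfadjoint selfadjoint_powr power_defined_nonneg a) simp
  then show "\<Phi> (cstar_powr a ((u + v) / 2)) \<le>\<^sub>* cstar_powr X ((u + v) / 2)"
    using block_positive_powr[OF X _ uv] block_positive_mono[OF map_powr_block_positive[OF a uv] le]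
    by blast
next
  fix \<sigma> :: "nat \<Rightarrow> real" and s :: real
  assume s: "s > 0" "\<And>n. \<sigma> n > 0" "\<sigma> \<longlonglongrightarrow> s"
    and le: "\<And>n. \<Phi> (cstar_powr a (\<sigma> n)) \<le>\<^sub>* cstar_powr X (\<sigma> n)"
  have "(\<lambda>n. \<Phi> (cstar_powr a (\<sigma> n))) \<longlonglongrightarrow> \<Phi> (cstar_powr a s)"
    using s(2) by (intro map_tendsto cstar_powr_tendsto_exponent a s selfadjoint_powr power_defined_nonneg)
      (simp add: less_imp_le)
  then show "\<Phi> (cstar_powr a s) \<le>\<^sub>* cstar_powr X s"
    by (rule tendsto_cstar_le[OF _ cstar_powr_tendsto_exponent[OF X s]]) (simp_all add: le)
qed (use s in auto)

text \<open>In the block with exponents \<open>1 + s\<close> and \<open>1 - s\<close> the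
  off-diagonal entry is \<open>\<Phi> a\<close> itself. The entry for \<open>1 - s\<close> may be
  raised to the power \<open>1 - s\<close> of \<open>\<Phi> a\<close> by \<open>map_powr_le\<close>,
  after which three entries are powers of one element.\<close>

lemma powr_one_plus_le_map:
  assumes a: "cstar_positive a" and s: "0 \<le> s" "s \<le> 1"
  shows "cstar_powr (\<Phi> a) (1 + s) \<le>\<^sub>* \<Phi> (cstar_powr a (1 + s))"
proof -
  let ?X = "\<Phi> a" and ?P = "cstar_powr (\<Phi> a)"
  have X: "cstar_positive ?X" using map_positive[OF a] .
  have add: "?P p * ?P q = ?P (p + q)" if "p \<ge> 0" "q \<ge> 0" for p q
    using that cstar_powr_add[of ?X p q] X by (simp add: power_defined_nonneg)
  have "block_positive (\<Phi> (cstar_powr a (1 + s))) (\<Phi> (cstar_powr a (((1 + s) + (1 - s)) / 2)))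
      (\<Phi> (cstar_powr a (1 - s)))"
    using s by (intro map_powr_block_positive a) auto
  then have "block_positive (\<Phi> (cstar_powr a (1 + s))) (?P 1) (\<Phi> (cstar_powr a (1 - s)))"
    using a X by (simp add: cstar_powr_one)
  then have "block_positive (\<Phi> (cstar_powr a (1 + s))) (?P 1) (?P (1 - s))"
  proof (rule block_positive_mono)
    show "\<Phi> (cstar_powr a (1 + s)) \<le>\<^sub>* \<Phi> (cstar_powr a (1 + s))"
      using s by (intro cstar_le_refl map_selfadjoint selfadjoint_powr power_defined_nonneg a) simp
    show "\<Phi> (cstar_powr a (1 - s)) \<le>\<^sub>* ?P (1 - s)"
      using s X by (intro map_powr_le a cstar_le_refl positive_selfadjoint) auto
  qed
  \<comment> \<open>The test vector \<open>(1, - ?P s)\<close> makes the form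
    \<open>\<Phi> (cstar_powr a (1 + s)) - 2 * ?P (1 + s) + ?P (1 + s)\<close>.\<close>
  then have "cstar_positive (star 1 * \<Phi> (cstar_powr a (1 + s)) * 1 + star 1 * ?P 1 * (- ?P s)
      + star (- ?P s) * ?P 1 * 1 + star (- ?P s) * ?P (1 - s) * (- ?P s))"
    unfolding block_positive_def by blast
  moreover have "star (?P s) = ?P s"
    using s X by (intro positive_star positive_powr power_defined_nonneg)
  ultimately have "cstar_positive (\<Phi> (cstar_powr a (1 + s)) - ?P (1 + s))"
    using s by (simp add: star_minus add add.commute)
  then show ?thesis
    using s a X by (simp add: cstar_le_def map_selfadjoint selfadjoint_powr power_defined_nonneg)
qed

end

text \<open>The identity map is positive and sub-unital, so this is \<open>map_powr_le\<close> with
  \<open>X = b\<close>.\<close>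

lemma loewner_heinz:
  assumes "cstar_positive a" "a \<le>\<^sub>* b" "0 \<le> s" "s \<le> 1"
  shows "cstar_powr a s \<le>\<^sub>* cstar_powr b s"
proof -
  interpret positive_subunital "\<lambda>x::'a. x"
    by unfold_locales (simp_all add: cstar_positive_linear_map_def cstar_le_refl selfadjoint_simps)
  show ?thesis using assms map_powr_le positive_of_le by blast
qed

section \<open>Furuta's inequality\<close>

text \<open>The hypothesis bounds the norm of \<open>a^(1/2) * b^(-1/2)\<close> by 1. Its adjoint
  has the same norm, which gives \<open>a^(1/2) * b^(-1) * a^(1/2) \<le> 1\<close>.\<close>

lemma cstar_powr_minus_one_antimono:
  assumes a: "cstar_positive a" "0 \<notin> cstar_spectrum a" and b: "cstar_positive b" "0 \<notin> cstar_spectrum b"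
    and le: "a \<le>\<^sub>* b"
  shows "cstar_powr b (- 1) \<le>\<^sub>* cstar_powr a (- 1)"
proof -
  have def: "power_defined a p" "power_defined b p" for p using a b by (simp_all add: power_defined_def)
  note adda = cstar_powr_add[OF def(1) def(1), symmetric] and addb = cstar_powr_add[OF def(2) def(2), symmetric]
  note sa = selfadjoint_powr[OF def(1)] selfadjoint_powr[OF def(2)]
  have star: "star (cstar_powr a p) = cstar_powr a p" "star (cstar_powr b p) = cstar_powr b p" for p
    using sa by (simp_all add: cstar_selfadjoint_def)
  let ?k = "cstar_powr a (1/2)" and ?k' = "cstar_powr a (- 1/2)" and ?h = "cstar_powr b (- 1/2)"
  have aa: "?k * ?k = a" using a by (simp add: cstar_powr_half_mult)
  have bb: "b = cstar_powr b (1/2) * cstar_powr b (1/2)" using b by (simp add: cstar_powr_half_mult)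
  have "?h * b * ?h = (?h * cstar_powr b (1/2)) * (cstar_powr b (1/2) * ?h)"
    by (subst (2) bb) (simp only: mult.assoc)
  also have "\<dots> = 1" using b by (simp add: addb cstar_powr_zero)
  finally have "?h * a * ?h \<le>\<^sub>* 1" using le_conj_selfadjoint[OF sa(2) le, of "- 1/2"] by simp
  moreover have "star (?k * ?h) * (?k * ?h) = ?h * (?k * ?k) * ?h"
    by (simp only: star_mult star mult.assoc)
  ultimately have "norm (star (?k * ?h) * (?k * ?h)) \<le> 1"
    using norm_le_of_positive_le[OF positive_star_mult_self, of "?k * ?h" 1] aa by simp
  then have "norm (?k * ?h) \<le> 1" by (simp add: cstar_identity power_le_one_iff)
  moreover have "?h * ?k = star (?k * ?h)" by (simp add: star_mult star)
  ultimately have "norm (?h * ?k) \<le> 1" by simp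
  then have "norm (star (?h * ?k) * (?h * ?k)) \<le> 1" by (simp add: cstar_identity power_le_one)
  then have "star (?h * ?k) * (?h * ?k) \<le>\<^sub>* 1"
    using le_norm[of "star (?h * ?k) * (?h * ?k)" 1] by (simp add: selfadjoint_simps)
  moreover have "star (?h * ?k) * (?h * ?k) = ?k * (?h * ?h) * ?k"
    by (simp only: star_mult star mult.assoc)
  moreover have "?h * ?h = cstar_powr b (- 1)" by (simp add: addb)
  ultimately have "?k * cstar_powr b (- 1) * ?k \<le>\<^sub>* 1" by simp
  from le_conj_selfadjoint[OF sa(1) this, of "- 1/2"]
  have "?k' * (?k * cstar_powr b (- 1) * ?k) * ?k' \<le>\<^sub>* ?k' * ?k'" by simp
  moreover have "?k' * (?k * cstar_powr b (- 1) * ?k) * ?k' = (?k' * ?k) * cstar_powr b (- 1) * (?k * ?k')"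
    by (simp only: mult.assoc)
  moreover have "?k' * ?k = 1" "?k * ?k' = 1" using a by (simp_all add: adda cstar_powr_zero)
  moreover have "?k' * ?k' = cstar_powr a (- 1)" by (simp add: adda)
  ultimately show ?thesis by simp
qed

lemma invertible_mult:
  assumes "0 \<notin> cstar_spectrum a" "0 \<notin> cstar_spectrum b" shows "0 \<notin> cstar_spectrum (a * b)"
  using assms is_inverse_mult unfolding zero_notin_spectrum_iff by blast

text \<open>
  With \<open>K = e f\<^sup>\<beta>\<close>, the left-hand side is \<open>|K| = K\<^sup>*(KK\<^sup>*)\<^sup>-\<^sup>1\<^sup>/\<^sup>2K\<close>, and
  \<open>KK\<^sup>* = e f\<^sup>2\<^sup>\<beta> e \<ge> e\<^sup>2\<^sup>+\<^sup>2\<^sup>\<beta>\<close>.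
\<close>

lemma furuta_step:
  assumes e: "cstar_positive e" "0 \<notin> cstar_spectrum e" and f: "cstar_positive f" "0 \<notin> cstar_spectrum f"
    and le: "e \<le>\<^sub>* f" and \<beta>: "0 \<le> \<beta>" "\<beta> \<le> 1/2"
  shows "cstar_powr (cstar_powr f \<beta> * (e * e) * cstar_powr f \<beta>) (1/2) \<le>\<^sub>* cstar_powr f (1 + \<beta>)"
proof -
  have def: "power_defined e p" "power_defined f p" for p using e f by (simp_all add: power_defined_def)
  note sa = selfadjoint_powr[OF def(1)] selfadjoint_powr[OF def(2)]
  let ?E = "cstar_powr e" and ?F = "cstar_powr f"
  have addE: "?E p * ?E q = ?E (p + q)" for p q using cstar_powr_add[OF def(1) def(1)] by simp
  have addF: "?F p * ?F q = ?F (p + q)" for p q using cstar_powr_add[OF def(2) def(2)] by simp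
  have e1: "e = ?E 1" using e by (simp add: cstar_powr_one)
  have se: "cstar_selfadjoint e" "star e = e" using e by (simp_all add: positive_selfadjoint positive_star)
  have sF: "star (?F p) = ?F p" for p using sa(2) by (simp add: cstar_selfadjoint_def)
  define G where "G = e * ?F (2 * \<beta>) * e"
  have G: "cstar_positive G" "0 \<notin> cstar_spectrum G"
    unfolding G_def by (intro positive_conj_selfadjoint se positive_powr def invertible_mult cstar_powr_invertible e f)+
  have defG: "power_defined G p" for p using G by (simp add: power_defined_def)
  \<comment> \<open>The restriction \<open>\<beta> \<le> 1/2\<close> brings the exponent
    \<open>2 * \<beta>\<close> into the range of \<open>loewner_heinz\<close>.\<close>
  have "e * ?E (2 * \<beta>) * e \<le>\<^sub>* G"
    unfolding G_def using \<beta> by (intro le_conj_selfadjoint se loewner_heinz e le) auto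
  moreover have "e * ?E (2 * \<beta>) * e = ?E (2 + 2 * \<beta>)"
    by (subst (1 3) e1) (simp add: addE add.commute add.left_commute)
  ultimately have "cstar_powr (?E (2 + 2 * \<beta>)) (1/2) \<le>\<^sub>* cstar_powr G (1/2)"
    using positive_powr[OF def(1)] by (metis cstar_powr_half_mono)
  moreover have "cstar_powr (?E (2 + 2 * \<beta>)) (1/2) = ?E (1 + \<beta>)"
    by (simp add: cstar_powr_powr[OF def(1) def(1)] add_divide_distrib)
  ultimately have "?E (1 + \<beta>) \<le>\<^sub>* cstar_powr G (1/2)" by simp
  then have "cstar_powr (cstar_powr G (1/2)) (- 1) \<le>\<^sub>* cstar_powr (?E (1 + \<beta>)) (- 1)"
    by (intro cstar_powr_minus_one_antimono positive_powr cstar_powr_invertible def defG e G)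
  then have inv: "cstar_powr G (- 1/2) \<le>\<^sub>* ?E (- 1 - \<beta>)"
    by (simp add: cstar_powr_powr[OF def(1) def(1)] cstar_powr_powr[OF defG defG])
  define H where "H = cstar_powr G (- 1/2)"
  define K where "K = e * ?F \<beta>"
  have starK: "star K = ?F \<beta> * e" by (simp add: K_def star_mult sF se)
  define Z where "Z = star K * H * K"
  have "K * star K = e * (?F \<beta> * ?F \<beta>) * e"
    unfolding starK unfolding K_def by (simp only: mult.assoc)
  also have "\<dots> = G" by (simp add: G_def addF)
  finally have KK: "K * star K = G" .
  have "Z * Z = star K * (H * (K * star K) * H) * K" unfolding Z_def by (simp only: mult.assoc)
  then have "Z * Z = star K * (H * G * H) * K" unfolding KK .
  moreover have "H * G * H = 1"
  proof -
    have "H * cstar_powr G 1 * H = cstar_powr G 0"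
      unfolding H_def by (simp add: cstar_powr_add[OF defG defG, symmetric])
    then show ?thesis using G by (simp add: cstar_powr_one cstar_powr_zero)
  qed
  ultimately have "Z * Z = star K * K" by simp
  then have "Z * Z = ?F \<beta> * (e * e) * ?F \<beta>"
    unfolding starK unfolding K_def by (simp only: mult.assoc)
  moreover have "cstar_positive Z"
    unfolding Z_def H_def by (intro positive_conj positive_powr defG)
  ultimately have "cstar_powr (?F \<beta> * (e * e) * ?F \<beta>) (1/2) = Z" by (rule cstar_powr_half_unique[rotated])
  moreover have "Z \<le>\<^sub>* ?F (1 + \<beta>)"
  proof -
    \<comment> \<open>The bound for \<open>H\<close> leaves \<open>?E (1 - \<beta>)\<close> in the
      middle, and its exponent is again in the Loewner-Heinz range.\<close>
    have "Z = ?F \<beta> * (e * H * e) * ?F \<beta>"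
      unfolding Z_def starK unfolding K_def by (simp only: mult.assoc)
    also have "\<dots> \<le>\<^sub>* ?F \<beta> * (e * ?E (- 1 - \<beta>) * e) * ?F \<beta>"
      unfolding H_def by (intro le_conj_selfadjoint sa se inv)
    also have "e * ?E (- 1 - \<beta>) * e = ?E (1 - \<beta>)" by (subst (1 3) e1) (simp add: addE)
    finally have "Z \<le>\<^sub>* ?F \<beta> * ?E (1 - \<beta>) * ?F \<beta>" .
    moreover have "?F \<beta> * ?E (1 - \<beta>) * ?F \<beta> \<le>\<^sub>* ?F \<beta> * ?F (1 - \<beta>) * ?F \<beta>"
      using \<beta> by (intro le_conj_selfadjoint sa loewner_heinz e le) auto
    moreover have "?F \<beta> * ?F (1 - \<beta>) * ?F \<beta> = ?F (1 + \<beta>)" by (simp add: addF)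
    ultimately show ?thesis using cstar_le_trans by metis
  qed
  ultimately show ?thesis by simp
qed

text \<open>Each induction step extends the range of \<open>\<alpha>\<close> by 1/2. The inequality
  at \<open>\<delta>\<close> is itself an order relation between the square root of
  \<open>?G \<delta>\<close> and \<open>?F (1 + \<delta>)\<close>, and \<open>furuta_step\<close>
  applied to this pair yields the inequality at \<open>\<alpha>\<close>.\<close>

lemma furuta:
  assumes e: "cstar_positive e" "0 \<notin> cstar_spectrum e" and f: "cstar_positive f" "0 \<notin> cstar_spectrum f"
    and le: "e \<le>\<^sub>* f" and \<alpha>: "0 \<le> \<alpha>"
  shows "cstar_powr (cstar_powr f \<alpha> * (e * e) * cstar_powr f \<alpha>) (1/2) \<le>\<^sub>* cstar_powr f (1 + \<alpha>)"
proof -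
  have def: "power_defined f p" for p using f by (simp add: power_defined_def)
  let ?F = "cstar_powr f"
  let ?G = "\<lambda>\<alpha>. ?F \<alpha> * (e * e) * ?F \<alpha>"
  have addF: "?F p * ?F q = ?F (p + q)" for p q using cstar_powr_add[OF def def] by simp
  have addF': "?F p * (?F q * z) = ?F (p + q) * z" for p q z by (simp add: addF flip: mult.assoc)
  have G: "cstar_positive (?G \<alpha>)" "0 \<notin> cstar_spectrum (?G \<alpha>)" for \<alpha>
    by (intro positive_conj_selfadjoint selfadjoint_powr def positive_square positive_selfadjoint e f
        invertible_mult cstar_powr_invertible)+
  have "\<forall>\<alpha>. 0 \<le> \<alpha> \<and> \<alpha> \<le> real n / 2 \<longrightarrow> cstar_powr (?G \<alpha>) (1/2) \<le>\<^sub>* ?F (1 + \<alpha>)" for n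
  proof (induction n)
    case 0
    have "cstar_powr (e * e) (1/2) = e" by (intro cstar_powr_half_unique e refl)
    then show ?case using f le by (auto simp: cstar_powr_zero cstar_powr_one)
  next
    case (Suc n)
    show ?case
    proof (intro allI impI)
      fix \<alpha> assume \<alpha>: "0 \<le> \<alpha> \<and> \<alpha> \<le> real (Suc n) / 2"
      show "cstar_powr (?G \<alpha>) (1/2) \<le>\<^sub>* ?F (1 + \<alpha>)"
      proof (cases "\<alpha> \<le> real n / 2")
        case True
        then show ?thesis using Suc.IH \<alpha> by blast
      next
        case False
        define \<delta> where "\<delta> = real n / 2"
        \<comment> \<open>Turns the power \<open>\<beta>\<close> of \<open>?F (1 + \<delta>)\<close>
          into \<open>?F (\<alpha> - \<delta>)\<close>; since \<open>1 + \<delta> \<ge> 1\<close>,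
          \<open>\<beta>\<close> stays at most 1/2.\<close>
        define \<beta> where "\<beta> = (\<alpha> - \<delta>) / (1 + \<delta>)"
        have \<delta>: "\<delta> \<ge> 0" by (simp add: \<delta>_def)
        have "0 \<le> \<alpha> - \<delta>" "\<alpha> - \<delta> \<le> 1/2" using \<alpha> False by (auto simp: \<delta>_def field_simps)
        then have \<beta>: "0 \<le> \<beta>" "\<beta> \<le> 1/2" using \<delta> by (auto simp: \<beta>_def divide_le_eq)
        have b: "(1 + \<delta>) * \<beta> = \<alpha> - \<delta>" using \<delta> by (simp add: \<beta>_def)
        let ?e = "cstar_powr (?G \<delta>) (1/2)" and ?f = "?F (1 + \<delta>)"
        have "cstar_powr (cstar_powr ?f \<beta> * (?e * ?e) * cstar_powr ?f \<beta>) (1/2) \<le>\<^sub>* cstar_powr ?f (1 + \<beta>)"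
        proof (rule furuta_step)
          show "?e \<le>\<^sub>* ?f" using Suc.IH \<delta> by (simp add: \<delta>_def)
        qed (intro positive_powr power_defined_nonneg cstar_powr_invertible G f def \<beta>; simp)+
        moreover have "?e * ?e = ?G \<delta>" by (rule cstar_powr_half_mult[OF G(1)])
        moreover have "cstar_powr ?f \<beta> = ?F (\<alpha> - \<delta>)" by (simp add: cstar_powr_powr[OF def def] b)
        moreover have "cstar_powr ?f (1 + \<beta>) = ?F (1 + \<alpha>)"
          using b by (simp add: cstar_powr_powr[OF def def] distrib_left)
        moreover have "?F (\<alpha> - \<delta>) * ?G \<delta> * ?F (\<alpha> - \<delta>) = ?G \<alpha>"
          by (simp add: mult.assoc addF addF')
        ultimately show ?thesis by simp
      qed
    qed
  qed
  moreover obtain n where "\<alpha> \<le> real n / 2" using real_arch_simple[of "2 * \<alpha>"] by (auto simp: field_simps)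
  ultimately show ?thesis using \<alpha> by blast
qed

text \<open>Shifting \<open>d\<close> and \<open>c\<close> by the same multiple of the unit
  preserves their order and makes both invertible. On the left the shift sits inside a product of
  noncommuting factors, so the limit under the root is taken by
  \<open>cstar_powr_half_le_limit\<close>.\<close>

lemma furuta_positive:
  assumes d: "cstar_positive (d::'a::cstar_algebra)" and le: "d \<le>\<^sub>* c" and \<alpha>: "0 \<le> \<alpha>"
  shows "cstar_powr (cstar_powr c \<alpha> * (d * d) * cstar_powr c \<alpha>) (1/2) \<le>\<^sub>* cstar_powr c (1 + \<alpha>)"
proof -
  have c: "cstar_positive c" using positive_of_le[OF d le] .
  define \<epsilon> where "\<epsilon> n = inverse (real (Suc n))" for n
  have pos: "\<epsilon> n > 0" for n by (simp add: \<epsilon>_def)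
  have "\<epsilon> \<longlonglongrightarrow> 0" unfolding \<epsilon>_def by (rule LIMSEQ_inverse_real_of_nat)
  then have \<epsilon>: "filterlim \<epsilon> (at_right 0) sequentially"
    using pos unfolding filterlim_at by (auto simp: less_imp_neq[THEN not_sym])
  let ?D = "\<lambda>n. d + \<epsilon> n *\<^sub>R 1" and ?C = "\<lambda>n. c + \<epsilon> n *\<^sub>R 1"
  have C: "(\<lambda>n. cstar_powr (?C n) p) \<longlonglongrightarrow> cstar_powr c p" if "p \<ge> 0" for p
    using filterlim_compose[OF cstar_powr_add_scale_tendsto[OF c that] \<epsilon>] .
  have "?D \<longlonglongrightarrow> d + 0 *\<^sub>R 1" using \<open>\<epsilon> \<longlonglongrightarrow> 0\<close> by (intro tendsto_intros)
  then have D: "?D \<longlonglongrightarrow> d" by simp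
  show ?thesis
  proof (rule cstar_powr_half_le_limit)
    show "cstar_positive (cstar_powr (?C n) \<alpha> * (?D n * ?D n) * cstar_powr (?C n) \<alpha>)" for n
      by (intro positive_conj_selfadjoint selfadjoint_powr power_defined_nonneg \<alpha> positive_square
          positive_selfadjoint add_scale_one pos c d)
    show "(\<lambda>n. cstar_powr (?C n) \<alpha> * (?D n * ?D n) * cstar_powr (?C n) \<alpha>)
        \<longlonglongrightarrow> cstar_powr c \<alpha> * (d * d) * cstar_powr c \<alpha>"
      by (intro tendsto_intros C D \<alpha>)
    show "(\<lambda>n. cstar_powr (?C n) (1 + \<alpha>)) \<longlonglongrightarrow> cstar_powr c (1 + \<alpha>)"
      using \<alpha> by (intro C) simp
    show "cstar_powr (cstar_powr (?C n) \<alpha> * (?D n * ?D n) * cstar_powr (?C n) \<alpha>) (1/2)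
        \<le>\<^sub>* cstar_powr (?C n) (1 + \<alpha>)" for n
    proof (rule furuta)
      show "?D n \<le>\<^sub>* ?C n"
        using le by (intro le_add_mono cstar_le_refl) (auto simp: selfadjoint_simps)
    qed (intro add_scale_one pos c d \<alpha>)+
  qed
qed

theorem theorem1p1:
  fixes \<Phi> :: "'a::cstar_algebra \<Rightarrow> 'm::cstar_algebra" and A :: 'a and p q :: real
  assumes "cstar_positive_linear_map \<Phi>"
    and "\<Phi> 1 \<le>\<^sub>* 1"
    and "cstar_positive A"
    and "0 \<le> p" and "p \<le> q"
  shows "cstar_abs (\<Phi> (cstar_powr A p) * \<Phi> (cstar_powr A q)) \<le>\<^sub>* \<Phi> (cstar_powr A (p + q))"
proof -
  interpret positive_subunital \<Phi> using assms(1,2) by (rule positive_subunital.intro)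
  define a where "a = cstar_powr A q"
  have a: "cstar_positive a"
    unfolding a_def using assms by (intro positive_powr power_defined_nonneg) auto
  define B where "B = \<Phi> (cstar_powr A p)"
  define Y where "Y = \<Phi> a"
  have Y: "cstar_positive Y" unfolding Y_def by (intro map_positive a)
  have B: "cstar_positive B"
    unfolding B_def using assms by (intro map_positive positive_powr power_defined_nonneg)
  have abs: "cstar_abs (B * Y) = cstar_powr (Y * (B * B) * Y) (1/2)"
    using positive_star[OF B] positive_star[OF Y] by (simp add: cstar_abs_def star_mult mult.assoc)
  show ?thesis
  proof (cases "p = 0")
    case True
    have "B \<le>\<^sub>* 1" using True assms by (simp add: B_def cstar_powr_zero)
    then have "norm B \<le> 1" using norm_le_of_positive_le[OF B, of 1] by simp
    then have "norm (B * B) \<le> 1"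
      using norm_selfadjoint_square[OF positive_selfadjoint[OF B]] by (simp add: power_le_one)
    then have "B * B \<le>\<^sub>* 1"
      using le_norm[of "B * B" 1] positive_selfadjoint[OF positive_square[OF positive_selfadjoint[OF B]]]
      by simp
    from le_conj_selfadjoint[OF positive_selfadjoint[OF Y] this]
    have "Y * (B * B) * Y \<le>\<^sub>* Y * Y" by simp
    then have "cstar_powr (Y * (B * B) * Y) (1/2) \<le>\<^sub>* cstar_powr (Y * Y) (1/2)"
      by (intro cstar_powr_half_mono positive_conj_selfadjoint positive_square positive_selfadjoint Y B)
    also have "cstar_powr (Y * Y) (1/2) = Y" by (intro cstar_powr_half_unique Y refl)
    finally have "cstar_abs (B * Y) \<le>\<^sub>* Y" by (simp only: abs)
    then show ?thesis unfolding B_def Y_def a_def by (simp add: True)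
  next
    case False
    then have p: "p > 0" and q: "q > 0" using assms by auto
    define s where "s = p / q"
    have s: "0 < s" "s \<le> 1" using p q assms by (auto simp: s_def)
    have defA: "power_defined A r" if "r \<ge> 0" for r using that assms by (simp add: power_defined_nonneg)
    have pw: "cstar_powr a r = cstar_powr A (q * r)" if "r \<ge> 0" for r
      unfolding a_def using q that by (simp add: cstar_powr_powr[OF defA defA])
    have as: "cstar_powr a s = cstar_powr A p" "cstar_powr a (1 + s) = cstar_powr A (p + q)"
      using s q by (simp_all add: pw s_def distrib_left add.commute)
    have "B \<le>\<^sub>* cstar_powr Y s"
      unfolding B_def as(1)[symmetric] Y_def
      using s by (intro map_powr_le a map_positive cstar_le_refl map_selfadjoint positive_selfadjoint) auto
    from furuta_positive[OF B this, of "1 / s"] s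
    have "cstar_powr (cstar_powr (cstar_powr Y s) (1 / s) * (B * B) * cstar_powr (cstar_powr Y s) (1 / s)) (1/2)
        \<le>\<^sub>* cstar_powr (cstar_powr Y s) (1 + 1 / s)"
      by simp
    moreover have "cstar_powr (cstar_powr Y s) r = cstar_powr Y (s * r)" if "r \<ge> 0" for r
      using s that Y by (simp add: cstar_powr_powr power_defined_nonneg)
    ultimately have "cstar_powr (Y * (B * B) * Y) (1/2) \<le>\<^sub>* cstar_powr Y (1 + s)"
      using s Y by (simp add: cstar_powr_one distrib_left add.commute)
    moreover have "cstar_powr Y (1 + s) \<le>\<^sub>* \<Phi> (cstar_powr a (1 + s))"
      unfolding Y_def using s by (intro powr_one_plus_le_map a) auto
    ultimately have "cstar_abs (B * Y) \<le>\<^sub>* \<Phi> (cstar_powr a (1 + s))"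
      unfolding abs by (rule cstar_le_trans)
    then show ?thesis unfolding as(2) unfolding B_def Y_def a_def .
  qed
qed

end
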